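(* Let $\mathbb{W}\subseteq\mathbb{V}$ be a closed linear subspace. Suppose that $f$ satisfies the structural assumption (A) stated in the context with a constant $0<\rho\le\frac{1}{C_P}$, and let $\Delta t\in\Lambda_f(\rho)$. Then, for any initial guess $u^0\in L^2(\Omega)$, the sequence $\{u^n\}_{n\ge1}\subset\mathbb{W}$ generated by \[ u^{n+1}\in\mathbb{W}:\qquad B_{\Delta t}(u^{n+1},v)=\ell_{\Delta t}(u^n;v)\qquad\forall v\in\mathbb{W},\qquad n\ge0, \] converges to a unique limit $u^\star\in\mathbb{W}$ with respect to the norm $|||\cdot|||_{\Delta t}$, and it holds $\langle E'(u^\star),w\rangle=0$ for all $w\in\mathbb{W}$.
   Context: $\Omega\subset\mathbb{R}^d$, $d\in\{1,2,3\}$, is an open bounded polytopal domain with boundary consisting of straight faces. $\mathbb{V}:=H^1_0(\Omega)$. For $\lambda>0$, $|||v|||_\lambda:=(\lambda\|\nabla v\|_{L^2(\Omega)}^2+\|v\|_{L^2(\Omega)}^2)^{1/2}$, $v\in\mathbb{V}$. $C_P>0$ is a constant depending only on $\Omega$ such that $\|v\|_{L^2(\Omega)}^2\le C_P\|\nabla v\|_{L^2(\Omega)}^2$ for all $v\in\mathbb{V}$. $f:\Omega\times\mathbb{R}\to\mathbb{R}$ is a function, with $f(\cdot,u)$ measurable for each $u\in\mathbb{R}$. For $\lambda>0$ let $\sigma_f(\lambda):=\operatorname{ess\,sup}_{\mathbf{x}\in\Omega}\sup_{u\in\mathbb{R}}\left|\frac{\partial f}{\partial u}(\mathbf{x},u)+\frac1\lambda\right|$,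 and for $\rho>0$ let $\Lambda_f(\rho):=\{\lambda>0:\sigma_f(\lambda)<\rho+\frac1\lambda\}$. Assumption (A) for $\rho>0$: (i) $f(\cdot,0)\in L^2(\Omega)$; (ii) $f$ is differentiable in the second variable; (iii) the set $\Lambda_f(\rho)$ is non-empty. $E'$ denotes the (Gâteaux) derivative of the energy $E(u)=\frac12\int_\Omega|\nabla u|^2\,d\mathbf{x}-\int_\Omega\int_0^{u(\mathbf{x})}f(\mathbf{x},s)\,ds\,d\mathbf{x}$, given by $\langle E'(u),v\rangle=\int_\Omega(\nabla u\cdot\nabla v-f(\mathbf{x},u)v)\,d\mathbf{x}$ for $u,v\in\mathbb{V}$. For $\lambda>0$: $B_\lambda(u,v):=\int_\Omega(\lambda\nabla u\cdot\nabla v+uv)\,d\mathbf{x}$ for $u,v\in\mathbb{V}$, and $\ell_\lambda(y;v):=\int_\Omega(y+\lambda f(\mathbf{x},y))v\,d\mathbf{x}$ for $y\in L^2(\Omega)$, $v\in\mathbb{V}$. *)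

theory Defs
  imports "HOL-Analysis.Analysis" "HOL-Probability.Essential_Supremum"
begin

section \<open>Domains\<close>

text \<open>The faces are flat pieces of dimension \<open>d - 1\<close>; for \<open>d = 1\<close> they are single points.\<close>

definition polytopal_domain :: "'a::euclidean_space set \<Rightarrow> bool" where
  "polytopal_domain \<Omega> \<longleftrightarrow> open \<Omega> \<and> bounded \<Omega> \<and> connected \<Omega> \<and> \<Omega> \<noteq> {} \<and>
     (\<exists>\<F>. finite \<F> \<and> (\<forall>F\<in>\<F>. polytope F \<and> aff_dim F = int DIM('a) - 1) \<and> frontier \<Omega> = \<Union>\<F>)"

section \<open>Lebesgue and Sobolev spaces\<close>

text \<open>Elements of \<open>L\<^sup>2(\<Omega>)\<close> are represented by functions on the whole space. Only their values on
  \<open>\<Omega>\<close> matter, and two functions represent the same element iff they agree almost everywhere on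
  \<open>\<Omega>\<close>.\<close>

definition L2 :: "'a::euclidean_space set \<Rightarrow> ('a \<Rightarrow> 'b::euclidean_space) set" where
  "L2 \<Omega> = {u. u \<in> borel_measurable (lebesgue_on \<Omega>) \<and>
               integrable (lebesgue_on \<Omega>) (\<lambda>x. (norm (u x))\<^sup>2)}"

definition L2_norm :: "'a::euclidean_space set \<Rightarrow> ('a \<Rightarrow> 'b::euclidean_space) \<Rightarrow> real" where
  "L2_norm \<Omega> u = sqrt (LINT x|lebesgue_on \<Omega>. (norm (u x))\<^sup>2)"

definition eq_AE :: "'a::euclidean_space set \<Rightarrow> ('a \<Rightarrow> real) \<Rightarrow> ('a \<Rightarrow> real) \<Rightarrow> bool" where
  "eq_AE \<Omega> u v \<longleftrightarrow> (AE x in lebesgue_on \<Omega>. u x = v x)"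

definition partial_deriv :: "'a::euclidean_space \<Rightarrow> ('a \<Rightarrow> real) \<Rightarrow> 'a \<Rightarrow> real" where
  "partial_deriv b \<phi> x = frechet_derivative \<phi> (at x) b"

fun k_times_cont_diff :: "nat \<Rightarrow> ('a::euclidean_space \<Rightarrow> real) \<Rightarrow> bool" where
  "k_times_cont_diff 0 \<phi> \<longleftrightarrow> continuous_on UNIV \<phi>"
| "k_times_cont_diff (Suc k) \<phi> \<longleftrightarrow> \<phi> differentiable_on UNIV \<and>
     (\<forall>b\<in>Basis. k_times_cont_diff k (partial_deriv b \<phi>))"

text \<open>\<open>C\<^sub>c\<^sup>\<infinity>(\<Omega>)\<close>, the functions being extended by zero outside \<open>\<Omega>\<close>.\<close>

definition test_functions :: "'a::euclidean_space set \<Rightarrow> ('a \<Rightarrow> real) set" where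
  "test_functions \<Omega> = {\<phi>. (\<forall>k. k_times_cont_diff k \<phi>) \<and>
     compact (closure {x. \<phi> x \<noteq> 0}) \<and> closure {x. \<phi> x \<noteq> 0} \<subseteq> \<Omega>}"

definition has_weak_gradient ::
    "'a::euclidean_space set \<Rightarrow> ('a \<Rightarrow> real) \<Rightarrow> ('a \<Rightarrow> 'a) \<Rightarrow> bool" where
  "has_weak_gradient \<Omega> u g \<longleftrightarrow> (\<forall>\<phi>\<in>test_functions \<Omega>. \<forall>b\<in>Basis.
     (LINT x|lebesgue_on \<Omega>. u x * partial_deriv b \<phi> x) = - (LINT x|lebesgue_on \<Omega>. (g x \<bullet> b) * \<phi> x))"

definition H1 :: "'a::euclidean_space set \<Rightarrow> ('a \<Rightarrow> real) set" where
  "H1 \<Omega> = {u \<in> L2 \<Omega>. \<exists>g\<in>L2 \<Omega>. has_weak_gradient \<Omega> u g}"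

text \<open>The weak gradient is determined almost everywhere on \<open>\<Omega>\<close>, so the choice of a
  representative is immaterial below.\<close>

definition wgrad :: "'a::euclidean_space set \<Rightarrow> ('a \<Rightarrow> real) \<Rightarrow> 'a \<Rightarrow> 'a" where
  "wgrad \<Omega> u = (SOME g. g \<in> L2 \<Omega> \<and> has_weak_gradient \<Omega> u g)"

definition energy_norm :: "'a::euclidean_space set \<Rightarrow> real \<Rightarrow> ('a \<Rightarrow> real) \<Rightarrow> real" where
  "energy_norm \<Omega> lam v = sqrt (lam * (L2_norm \<Omega> (wgrad \<Omega> v))\<^sup>2 + (L2_norm \<Omega> v)\<^sup>2)"

definition energy_converges ::
    "'a::euclidean_space set \<Rightarrow> real \<Rightarrow> (nat \<Rightarrow> 'a \<Rightarrow> real) \<Rightarrow> ('a \<Rightarrow> real) \<Rightarrow> bool" where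
  "energy_converges \<Omega> lam u v \<longleftrightarrow> (\<lambda>n. energy_norm \<Omega> lam (\<lambda>x. u n x - v x)) \<longlonglongrightarrow> 0"

text \<open>\<open>H\<^sup>1\<^sub>0(\<Omega>)\<close> is the closure of \<open>C\<^sub>c\<^sup>\<infinity>(\<Omega>)\<close> in \<open>H\<^sup>1(\<Omega>)\<close>; for \<open>lam = 1\<close> the norm above is
  the usual norm of \<open>H\<^sup>1(\<Omega>)\<close>.\<close>

definition H10 :: "'a::euclidean_space set \<Rightarrow> ('a \<Rightarrow> real) set" where
  "H10 \<Omega> = {u \<in> H1 \<Omega>. \<exists>\<phi>. (\<forall>n. \<phi> n \<in> test_functions \<Omega>) \<and> energy_converges \<Omega> 1 \<phi> u}"

text \<open>By the closedness clause, a closed subspace contains with a function all its other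
  representatives in \<open>H\<^sup>1\<^sub>0(\<Omega>)\<close>.\<close>

definition closed_subspace_H10 :: "'a::euclidean_space set \<Rightarrow> ('a \<Rightarrow> real) set \<Rightarrow> bool" where
  "closed_subspace_H10 \<Omega> W \<longleftrightarrow> W \<subseteq> H10 \<Omega> \<and> (\<lambda>x. 0) \<in> W \<and>
     (\<forall>u\<in>W. \<forall>v\<in>W. (\<lambda>x. u x + v x) \<in> W) \<and> (\<forall>c. \<forall>u\<in>W. (\<lambda>x. c * u x) \<in> W) \<and>
     (\<forall>w. \<forall>u\<in>H10 \<Omega>. (\<forall>n. w n \<in> W) \<and> energy_converges \<Omega> 1 w u \<longrightarrow> u \<in> W)"

definition poincare_constant :: "'a::euclidean_space set \<Rightarrow> real \<Rightarrow> bool" where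
  "poincare_constant \<Omega> C \<longleftrightarrow> C > 0 \<and>
     (\<forall>v\<in>H10 \<Omega>. (L2_norm \<Omega> v)\<^sup>2 \<le> C * (L2_norm \<Omega> (wgrad \<Omega> v))\<^sup>2)"

section \<open>The nonlinearity\<close>

text \<open>\<open>esssup\<close> is \<open>\<infinity>\<close> by convention for non-measurable functions. This does not interfere: if
  \<open>f\<close> is measurable in the first and differentiable in the second variable, the inner supremum
  is the least Lipschitz constant of \<open>s \<mapsto> f x s + s / lam\<close>, hence a supremum over countably many
  difference quotients and measurable in \<open>x\<close>.\<close>

definition sigma_f :: "'a::euclidean_space set \<Rightarrow> ('a \<Rightarrow> real \<Rightarrow> real) \<Rightarrow> real \<Rightarrow> ereal" where
  "sigma_f \<Omega> f lam = esssup (lebesgue_on \<Omega>) (\<lambda>x. SUP s. ereal \<bar>deriv (f x) s + 1 / lam\<bar>)"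

definition Lambda_f :: "'a::euclidean_space set \<Rightarrow> ('a \<Rightarrow> real \<Rightarrow> real) \<Rightarrow> real \<Rightarrow> real set" where
  "Lambda_f \<Omega> f \<rho> = {lam. lam > 0 \<and> sigma_f \<Omega> f lam < ereal (\<rho> + 1 / lam)}"

definition assumption_A :: "'a::euclidean_space set \<Rightarrow> ('a \<Rightarrow> real \<Rightarrow> real) \<Rightarrow> real \<Rightarrow> bool" where
  "assumption_A \<Omega> f \<rho> \<longleftrightarrow> (\<lambda>x. f x 0) \<in> L2 \<Omega> \<and>
     (\<forall>x\<in>\<Omega>. \<forall>s. f x differentiable (at s)) \<and> Lambda_f \<Omega> f \<rho> \<noteq> {}"

section \<open>Energy and iteration\<close>

definition energy ::
    "'a::euclidean_space set \<Rightarrow> ('a \<Rightarrow> real \<Rightarrow> real) \<Rightarrow> ('a \<Rightarrow> real) \<Rightarrow> real" where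
  "energy \<Omega> f u = 1 / 2 * (LINT x|lebesgue_on \<Omega>. (norm (wgrad \<Omega> u x))\<^sup>2)
     - (LINT x|lebesgue_on \<Omega>. (LBINT s=0..u x. f x s))"

definition energy_deriv ::
    "'a::euclidean_space set \<Rightarrow> ('a \<Rightarrow> real \<Rightarrow> real) \<Rightarrow> ('a \<Rightarrow> real) \<Rightarrow> ('a \<Rightarrow> real) \<Rightarrow> real" where
  "energy_deriv \<Omega> f u v = (LINT x|lebesgue_on \<Omega>. wgrad \<Omega> u x \<bullet> wgrad \<Omega> v x - f x (u x) * v x)"

definition has_gateaux_derivative_H10 :: "'a::euclidean_space set \<Rightarrow> (('a \<Rightarrow> real) \<Rightarrow> real) \<Rightarrow>
    ('a \<Rightarrow> real) \<Rightarrow> (('a \<Rightarrow> real) \<Rightarrow> real) \<Rightarrow> bool" where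
  "has_gateaux_derivative_H10 \<Omega> E u D \<longleftrightarrow>
     (\<forall>v\<in>H10 \<Omega>. ((\<lambda>t. E (\<lambda>x. u x + t * v x)) has_real_derivative D v) (at 0))"

definition B_form ::
    "'a::euclidean_space set \<Rightarrow> real \<Rightarrow> ('a \<Rightarrow> real) \<Rightarrow> ('a \<Rightarrow> real) \<Rightarrow> real" where
  "B_form \<Omega> lam u v = (LINT x|lebesgue_on \<Omega>. lam * (wgrad \<Omega> u x \<bullet> wgrad \<Omega> v x) + u x * v x)"

definition l_form :: "'a::euclidean_space set \<Rightarrow> ('a \<Rightarrow> real \<Rightarrow> real) \<Rightarrow> real \<Rightarrow>
    ('a \<Rightarrow> real) \<Rightarrow> ('a \<Rightarrow> real) \<Rightarrow> real" where
  "l_form \<Omega> f lam y v = (LINT x|lebesgue_on \<Omega>. (y x + lam * f x (y x)) * v x)"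

definition generated_sequence :: "'a::euclidean_space set \<Rightarrow> ('a \<Rightarrow> real \<Rightarrow> real) \<Rightarrow>
    ('a \<Rightarrow> real) set \<Rightarrow> real \<Rightarrow> ('a \<Rightarrow> real) \<Rightarrow> (nat \<Rightarrow> 'a \<Rightarrow> real) \<Rightarrow> bool" where
  "generated_sequence \<Omega> f W dt u0 u \<longleftrightarrow> u 0 = u0 \<and>
     (\<forall>n. u (Suc n) \<in> W \<and> (\<forall>v\<in>W. B_form \<Omega> dt (u (Suc n)) v = l_form \<Omega> f dt (u n) v))"

end

theory Submission
  imports Defs
begin

text \<open>Put \<open>\<sigma> = \<sigma>\<^sub>f(\<Delta>t)\<close>. By the mean value theorem \<open>s \<mapsto> s + \<Delta>t f(x, s)\<close> is Lipschitz with constant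
  \<open>K = \<Delta>t \<sigma>\<close> (or slightly more), and \<open>\<Delta>t \<in> \<Lambda>\<^sub>f(\<rho>)\<close> means that \<open>K < 1 + \<Delta>t \<rho>\<close>. The difference \<open>d\<close> of
  two iterates satisfies \<open>\<Delta>t \<parallel>\<nabla>d\<parallel>\<^sup>2 + \<parallel>d\<parallel>\<^sup>2 \<le> K \<parallel>d'\<parallel> \<parallel>d\<parallel>\<close>, where \<open>d'\<close> is the previous difference. As
  \<open>\<rho> \<parallel>d\<parallel>\<^sup>2 \<le> \<parallel>\<nabla>d\<parallel>\<^sup>2\<close> by the Poincare inequality, the iteration contracts the \<open>L\<^sup>2\<close> norm by the factor
  \<open>K / (1 + \<Delta>t \<rho>) < 1\<close>, and it controls the energy norm by the previous \<open>L\<^sup>2\<close> norm. Hence it converges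
  to its unique fixed point, and the fixed point equation says \<open>E'(u\<^sup>\<star>) = 0\<close> on \<open>\<W>\<close>. Each step is solvable
  because \<open>u \<mapsto> (u, \<surd>\<Delta>t \<nabla>u)\<close> is an isometry onto a closed subspace of an \<open>L\<^sup>2\<close> space, where the
  solution is an orthogonal projection.\<close>

section \<open>The space \<open>L\<^sup>2\<close>\<close>

text \<open>All objects are functions rather than classes, and \<open>wgrad\<close> is an arbitrary
  choice among the weak gradients. Even linearity of the gradient therefore holds only almost
  everywhere and rests on uniqueness of weak gradients. Uniqueness needs the fundamental lemma of
  the calculus of variations, and that lemma needs explicit smooth bumps; this is the reason for the
  long preparation before the Sobolev spaces. The contraction is measured in \<open>L2_norm\<close>
  for two reasons: the initial guess has no gradient, and the Lipschitz bound on s +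
  \<open>dt\<close> f(x, s) controls values only. The gradient part of \<open>B_form\<close> enters
  through the Poincare inequality, where it supplies the gain \<open>dt * \<rho>\<close> in the
  denominator. The strict inequality in \<open>Lambda_f\<close> leaves room for a real
  \<open>K\<close> between the extended real \<open>dt * sigma_f\<close> and 1 +
  \<open>dt * \<rho>\<close>. That E' really is the Gateaux derivative follows from the same
  Lipschitz bound: it makes the Taylor remainder of the potential quadratic.\<close>

definition L2_inner :: "'a::euclidean_space set \<Rightarrow> ('a \<Rightarrow> 'b::euclidean_space) \<Rightarrow> ('a \<Rightarrow> 'b) \<Rightarrow> real" where
  "L2_inner \<Omega> u v = (LINT x|lebesgue_on \<Omega>. u x \<bullet> v x)"

lemma L2_measurable: "u \<in> L2 \<Omega> \<Longrightarrow> u \<in> borel_measurable (lebesgue_on \<Omega>)"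
  by (simp add: L2_def)

lemma L2_integrable_norm_sq: "u \<in> L2 \<Omega> \<Longrightarrow> integrable (lebesgue_on \<Omega>) (\<lambda>x. (norm (u x))\<^sup>2)"
  by (simp add: L2_def)

text \<open>The two value spaces may differ, so that a vector field such as \<phi> times a basis
  vector can be dominated by a scalar function, and a component by the whole field.\<close>

lemma L2_bound:
  fixes u :: "'a::euclidean_space \<Rightarrow> 'b::euclidean_space" and v :: "'a \<Rightarrow> 'c::euclidean_space"
  assumes "u \<in> borel_measurable (lebesgue_on \<Omega>)" "v \<in> L2 \<Omega>"
    and "AE x in lebesgue_on \<Omega>. norm (u x) \<le> norm (v x)"
  shows "u \<in> L2 \<Omega>"
proof -
  have "integrable (lebesgue_on \<Omega>) (\<lambda>x. (norm (u x))\<^sup>2)"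
  proof (rule Bochner_Integration.integrable_bound[OF L2_integrable_norm_sq[OF assms(2)]])
    show "AE x in lebesgue_on \<Omega>. norm ((norm (u x))\<^sup>2) \<le> norm ((norm (v x))\<^sup>2)"
      using assms(3) by eventually_elim (simp add: power_mono)
  qed (use assms(1) in measurable)
  then show ?thesis using assms(1) by (simp add: L2_def)
qed

lemma L2_integrable_inner:
  assumes "u \<in> L2 \<Omega>" "v \<in> L2 \<Omega>"
  shows "integrable (lebesgue_on \<Omega>) (\<lambda>x. u x \<bullet> v x)"
proof (rule Bochner_Integration.integrable_bound)
  show "integrable (lebesgue_on \<Omega>) (\<lambda>x. (norm (u x))\<^sup>2 + (norm (v x))\<^sup>2)"
    using assms by (simp add: L2_def)
  show "(\<lambda>x. u x \<bullet> v x) \<in> borel_measurable (lebesgue_on \<Omega>)"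
    using assms by (intro borel_measurable_inner L2_measurable)
  have "\<bar>a \<bullet> b\<bar> \<le> (norm a)\<^sup>2 + (norm b)\<^sup>2" for a b :: 'b
  proof -
    have "\<bar>a \<bullet> b\<bar> \<le> norm a * norm b" by (rule Cauchy_Schwarz_ineq2)
    also have "\<dots> \<le> (norm a)\<^sup>2 + (norm b)\<^sup>2"
      using sum_squares_bound[of "norm a" "norm b"] mult_nonneg_nonneg[OF norm_ge_zero norm_ge_zero, of a b]
      by linarith
    finally show ?thesis .
  qed
  then show "AE x in lebesgue_on \<Omega>. norm (u x \<bullet> v x) \<le> norm ((norm (u x))\<^sup>2 + (norm (v x))\<^sup>2)"
    by (auto intro!: AE_I2)
qed

lemma L2_zero: "(\<lambda>x. 0) \<in> L2 \<Omega>"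
  by (simp add: L2_def)

lemma L2_scale: "u \<in> L2 \<Omega> \<Longrightarrow> (\<lambda>x. c *\<^sub>R u x) \<in> L2 \<Omega>"
  by (auto simp: L2_def power_mult_distrib intro!: borel_measurable_scaleR)

lemma L2_add:
  fixes u v :: "'a::euclidean_space \<Rightarrow> 'b::euclidean_space"
  assumes "u \<in> L2 \<Omega>" "v \<in> L2 \<Omega>"
  shows "(\<lambda>x. u x + v x) \<in> L2 \<Omega>"
proof -
  have "(\<lambda>x. (norm (u x + v x))\<^sup>2) = (\<lambda>x. (norm (u x))\<^sup>2 + (norm (v x))\<^sup>2 + 2 * (u x \<bullet> v x))"
    by (simp add: power2_norm_eq_inner inner_add_left inner_add_right inner_commute fun_eq_iff)
  then show ?thesis using assms L2_integrable_inner[OF assms] by (auto simp: L2_def intro: borel_measurable_add)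
qed

lemma L2_diff:
  assumes "u \<in> L2 \<Omega>" "v \<in> L2 \<Omega>"
  shows "(\<lambda>x. u x - v x) \<in> L2 \<Omega>"
  using L2_add[OF assms(1) L2_scale[OF assms(2), of "-1"]] by simp

lemma L2_inner_commute: "L2_inner \<Omega> u v = L2_inner \<Omega> v u"
  by (simp add: L2_inner_def inner_commute)

lemma L2_inner_add_left:
  "u \<in> L2 \<Omega> \<Longrightarrow> v \<in> L2 \<Omega> \<Longrightarrow> w \<in> L2 \<Omega> \<Longrightarrow>
    L2_inner \<Omega> (\<lambda>x. u x + v x) w = L2_inner \<Omega> u w + L2_inner \<Omega> v w"
  by (simp add: L2_inner_def inner_add_left L2_integrable_inner)

lemma L2_inner_diff_left:
  "u \<in> L2 \<Omega> \<Longrightarrow> v \<in> L2 \<Omega> \<Longrightarrow> w \<in> L2 \<Omega> \<Longrightarrow>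
    L2_inner \<Omega> (\<lambda>x. u x - v x) w = L2_inner \<Omega> u w - L2_inner \<Omega> v w"
  by (simp add: L2_inner_def inner_diff_left L2_integrable_inner)

lemma L2_inner_scale_left: "L2_inner \<Omega> (\<lambda>x. c *\<^sub>R u x) w = c * L2_inner \<Omega> u w"
  by (simp add: L2_inner_def)

lemma L2_norm_sq: "(L2_norm \<Omega> u)\<^sup>2 = L2_inner \<Omega> u u"
  by (simp add: L2_norm_def L2_inner_def power2_norm_eq_inner)

lemma L2_norm_nonneg: "0 \<le> L2_norm \<Omega> u"
  by (simp add: L2_norm_def)

lemma L2_inner_cong_AE:
  assumes "u \<in> L2 \<Omega>" "v \<in> L2 \<Omega>" "u' \<in> L2 \<Omega>" "v' \<in> L2 \<Omega>"
    and "AE x in lebesgue_on \<Omega>. u x = u' x" "AE x in lebesgue_on \<Omega>. v x = v' x"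
  shows "L2_inner \<Omega> u v = L2_inner \<Omega> u' v'"
  unfolding L2_inner_def
  by (rule integral_cong_AE) (use assms in \<open>auto simp: L2_def\<close>)

lemma L2_norm_cong_AE:
  assumes "u \<in> L2 \<Omega>" "v \<in> L2 \<Omega>" "AE x in lebesgue_on \<Omega>. u x = v x"
  shows "L2_norm \<Omega> u = L2_norm \<Omega> v"
  using L2_inner_cong_AE[OF assms(1,1,2,2,3,3)]
  by (simp add: L2_norm_def L2_inner_def power2_norm_eq_inner)

lemma L2_norm_scale: "L2_norm \<Omega> (\<lambda>x. c *\<^sub>R u x) = \<bar>c\<bar> * L2_norm \<Omega> u"
  by (simp add: L2_norm_def power_mult_distrib real_sqrt_mult)

lemma L2_norm_minus_commute: "L2_norm \<Omega> (\<lambda>x. u x - v x) = L2_norm \<Omega> (\<lambda>x. v x - u x)"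
  by (simp add: L2_norm_def norm_minus_commute)

lemma L2_norm_sq_add:
  assumes "u \<in> L2 \<Omega>" "v \<in> L2 \<Omega>"
  shows "(L2_norm \<Omega> (\<lambda>x. u x + v x))\<^sup>2 = (L2_norm \<Omega> u)\<^sup>2 + 2 * L2_inner \<Omega> u v + (L2_norm \<Omega> v)\<^sup>2"
proof -
  have "L2_inner \<Omega> w (\<lambda>x. u x + v x) = L2_inner \<Omega> w u + L2_inner \<Omega> w v" if "w \<in> L2 \<Omega>" for w
    using L2_inner_add_left[OF assms that] by (simp only: L2_inner_commute)
  then show ?thesis
    unfolding L2_norm_sq using assms L2_inner_commute[of \<Omega> v u] L2_add[OF assms]
    by (simp add: L2_inner_add_left)
qed

lemma L2_norm_sq_diff:
  assumes "u \<in> L2 \<Omega>" "v \<in> L2 \<Omega>"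
  shows "(L2_norm \<Omega> (\<lambda>x. u x - v x))\<^sup>2 = (L2_norm \<Omega> u)\<^sup>2 - 2 * L2_inner \<Omega> u v + (L2_norm \<Omega> v)\<^sup>2"
proof -
  have "L2_inner \<Omega> w (\<lambda>x. u x - v x) = L2_inner \<Omega> w u - L2_inner \<Omega> w v" if "w \<in> L2 \<Omega>" for w
    using L2_inner_diff_left[OF assms that] by (simp only: L2_inner_commute)
  then show ?thesis
    unfolding L2_norm_sq using assms L2_inner_commute[of \<Omega> v u] L2_diff[OF assms]
    by (simp add: L2_inner_diff_left)
qed

lemma L2_norm_eq_0_iff:
  assumes "u \<in> L2 \<Omega>"
  shows "L2_norm \<Omega> u = 0 \<longleftrightarrow> (AE x in lebesgue_on \<Omega>. u x = 0)"
  using assms unfolding L2_norm_def L2_def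
  by (subst real_sqrt_eq_0_iff, subst integral_nonneg_eq_0_iff_AE) auto

text \<open>The squared norm of u - t v is a nonnegative quadratic polynomial in t, so its
  discriminant is not positive. A zero leading coefficient is treated separately.\<close>

lemma L2_Cauchy_Schwarz:
  assumes u: "u \<in> L2 \<Omega>" and v: "v \<in> L2 \<Omega>"
  shows "\<bar>L2_inner \<Omega> u v\<bar> \<le> L2_norm \<Omega> u * L2_norm \<Omega> v"
proof -
  define a b c where "a = (L2_norm \<Omega> u)\<^sup>2" and "b = L2_inner \<Omega> u v" and "c = (L2_norm \<Omega> v)\<^sup>2"
  have quad: "0 \<le> a - 2 * t * b + t\<^sup>2 * c" for t
  proof -
    have "(L2_norm \<Omega> (\<lambda>x. u x - t *\<^sub>R v x))\<^sup>2 = a - 2 * t * b + t\<^sup>2 * c"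
      by (subst L2_norm_sq_diff[OF u L2_scale[OF v]])
         (simp add: a_def b_def c_def L2_norm_scale power_mult_distrib L2_inner_commute[of _ u] L2_inner_scale_left)
    then show ?thesis by (metis zero_le_power2)
  qed
  have "c \<ge> 0" by (simp add: c_def)
  have "b\<^sup>2 \<le> a * c"
  proof (cases "c = 0")
    case True
    have "b = 0"
    proof (rule ccontr)
      assume "b \<noteq> 0"
      \<comment> \<open>For c = 0 the polynomial is a - 2 t b, and this t gives it the value
        -1.\<close>
      then show False using quad[of "(a + 1) / (2 * b)"] True by simp
    qed
    then show ?thesis using True by simp
  next
    case False
    then have "c > 0" using \<open>c \<ge> 0\<close> by simp
    \<comment> \<open>b / c is the minimiser of the polynomial.\<close>
    have "0 \<le> (a - 2 * (b / c) * b + (b / c)\<^sup>2 * c) * c"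
      using quad[of "b / c"] \<open>c \<ge> 0\<close> by simp
    also have "\<dots> = a * c - b\<^sup>2"
      using \<open>c > 0\<close> by (simp add: field_simps power2_eq_square)
    finally show ?thesis by simp
  qed
  then have "\<bar>b\<bar>\<^sup>2 \<le> (L2_norm \<Omega> u * L2_norm \<Omega> v)\<^sup>2"
    by (simp add: a_def c_def power_mult_distrib)
  then show ?thesis
    unfolding b_def by (rule power2_le_imp_le) (simp add: L2_norm_nonneg)
qed

lemma L2_norm_triangle:
  assumes "u \<in> L2 \<Omega>" "v \<in> L2 \<Omega>"
  shows "L2_norm \<Omega> (\<lambda>x. u x + v x) \<le> L2_norm \<Omega> u + L2_norm \<Omega> v"
proof (rule power2_le_imp_le)
  show "(L2_norm \<Omega> (\<lambda>x. u x + v x))\<^sup>2 \<le> (L2_norm \<Omega> u + L2_norm \<Omega> v)\<^sup>2"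
    using L2_Cauchy_Schwarz[OF assms] unfolding L2_norm_sq_add[OF assms] power2_sum by linarith
qed (simp add: L2_norm_nonneg)

lemma L2_dist_triangle:
  assumes "u \<in> L2 \<Omega>" "v \<in> L2 \<Omega>" "w \<in> L2 \<Omega>"
  shows "L2_norm \<Omega> (\<lambda>x. u x - w x) \<le> L2_norm \<Omega> (\<lambda>x. u x - v x) + L2_norm \<Omega> (\<lambda>x. v x - w x)"
  using L2_norm_triangle[OF L2_diff[OF assms(1,2)] L2_diff[OF assms(2,3)]] by simp

section \<open>Limits in the L^2 spaces: weak continuity, completeness, orthogonal
  projection\<close>

lemma L2_inner_tendsto:
  assumes "\<And>n. u n \<in> L2 \<Omega>" "u' \<in> L2 \<Omega>" "v \<in> L2 \<Omega>"
    and "(\<lambda>n. L2_norm \<Omega> (\<lambda>x. u n x - u' x)) \<longlonglongrightarrow> 0"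
  shows "(\<lambda>n. L2_inner \<Omega> (u n) v) \<longlonglongrightarrow> L2_inner \<Omega> u' v"
proof (rule LIM_zero_cancel, rule Lim_null_comparison)
  show "\<forall>\<^sub>F n in sequentially. norm (L2_inner \<Omega> (u n) v - L2_inner \<Omega> u' v)
      \<le> L2_norm \<Omega> (\<lambda>x. u n x - u' x) * L2_norm \<Omega> v"
    using L2_Cauchy_Schwarz[OF L2_diff[OF assms(1,2)] assms(3)] assms
    by (simp add: L2_inner_diff_left)
  show "(\<lambda>n. L2_norm \<Omega> (\<lambda>x. u n x - u' x) * L2_norm \<Omega> v) \<longlonglongrightarrow> 0"
    by (rule tendsto_mult_left_zero[OF assms(4)])
qed

text \<open>Along a subsequence with increments at most \<open>4\<^sup>-\<^sup>k\<close>, the sum of \<open>4\<^sup>k\<close> times the squared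
  increments is integrable, hence finite almost everywhere; by \<open>2ab \<le> a\<^sup>2 + b\<^sup>2\<close> the increments
  are then summable at almost every point.\<close>

lemma L2_fast_Cauchy_AE_convergent:
  fixes w :: "nat \<Rightarrow> 'a::euclidean_space \<Rightarrow> 'b::euclidean_space"
  assumes w: "\<And>k. w k \<in> L2 \<Omega>"
    and fast: "\<And>k. L2_norm \<Omega> (\<lambda>x. w (Suc k) x - w k x) \<le> (1/4)^k"
  shows "AE x in lebesgue_on \<Omega>. convergent (\<lambda>k. w k x)"
proof -
  define s where "s k x = 4^k * (norm (w (Suc k) x - w k x))\<^sup>2" for k x
  have s_int: "integrable (lebesgue_on \<Omega>) (s k)" for k
    using L2_integrable_norm_sq[OF L2_diff[OF w[of "Suc k"] w[of k]]] by (simp add: s_def[abs_def])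
  have s_le: "(LINT x|lebesgue_on \<Omega>. s k x) \<le> (1/4)^k" for k
  proof -
    have "(LINT x|lebesgue_on \<Omega>. s k x) = 4^k * (L2_norm \<Omega> (\<lambda>x. w (Suc k) x - w k x))\<^sup>2"
      by (simp add: s_def L2_norm_def)
    also have "\<dots> \<le> 4^k * ((1/4)^k)\<^sup>2"
      using fast[of k] by (intro mult_left_mono power_mono) (auto simp: L2_norm_nonneg)
    also have "\<dots> = (1/4)^k"
      by (simp add: power2_eq_square power_one_over)
    finally show ?thesis .
  qed
  have "(\<integral>\<^sup>+x. (\<Sum>k. ennreal (s k x)) \<partial>lebesgue_on \<Omega>) = (\<Sum>k. \<integral>\<^sup>+x. ennreal (s k x) \<partial>lebesgue_on \<Omega>)"
    using s_int by (intro nn_integral_suminf) auto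
  also have "\<dots> = (\<Sum>k. ennreal (LINT x|lebesgue_on \<Omega>. s k x))"
    by (intro suminf_cong nn_integral_eq_integral s_int) (auto simp: s_def)
  also have "\<dots> \<le> (\<Sum>k. ennreal ((1/4)^k))"
    using s_le by (intro suminf_le ennreal_leI) auto
  also have "\<dots> = ennreal (\<Sum>k. (1/4)^k)"
    by (intro suminf_ennreal2) (auto intro!: summable_geometric)
  finally have "(\<integral>\<^sup>+x. (\<Sum>k. ennreal (s k x)) \<partial>lebesgue_on \<Omega>) \<noteq> \<infinity>"
    using ennreal_less_top by (auto simp: top_unique)
  then have "AE x in lebesgue_on \<Omega>. (\<Sum>k. ennreal (s k x)) \<noteq> \<infinity>"
    using s_int by (intro nn_integral_noteq_infinite) auto
  then show ?thesis
  proof eventually_elim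
    case (elim x)
    have sum_s: "summable (\<lambda>k. s k x)"
      using elim by (intro summable_suminf_not_top) (auto simp: s_def)
    have "summable (\<lambda>k. (1/4)^k + s k x :: real)"
      by (intro summable_add sum_s summable_geometric) auto
    then have "summable (\<lambda>k. w (Suc k) x - w k x)"
    proof (rule summable_comparison_test[rotated], intro exI allI impI)
      fix k
      \<comment> \<open>The weights 2^-k and 2^k are chosen so that the two squares are (1/4)^k and
        \<open>s k x\<close>, both summable in k.\<close>
      have "2 * norm (w (Suc k) x - w k x) = 2 * (1/2)^k * (2^k * norm (w (Suc k) x - w k x))"
        by (simp add: power_one_over)
      also have "\<dots> \<le> ((1/2)^k)\<^sup>2 + (2^k * norm (w (Suc k) x - w k x))\<^sup>2"
        by (rule sum_squares_bound)
      also have "\<dots> = (1/4)^k + s k x"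
      proof -
        have "((2::real)^k)\<^sup>2 = 4^k"
          by (simp add: power2_eq_square flip: power_mult_distrib)
        then show ?thesis by (simp add: s_def power_mult_distrib power_one_over)
      qed
      finally show "norm (w (Suc k) x - w k x) \<le> (1/4)^k + s k x"
        using norm_ge_zero[of "w (Suc k) x - w k x"] by linarith
    qed
    then have "convergent (\<lambda>n. \<Sum>k<n. (w (Suc k) x - w k x))"
      by (simp add: summable_iff_convergent)
    then have "convergent (\<lambda>n. (\<Sum>k<n. w (Suc k) x - w k x) + w 0 x)"
      by (intro convergent_add convergent_const)
    moreover have "(\<Sum>k<n. w (Suc k) x - w k x) + w 0 x = w n x" for n
      by (induction n) (simp_all add: algebra_simps)
    ultimately show ?case by simp
  qed
qed

text \<open>Turns almost everywhere convergence of a subsequence into norm information: with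
  \<open>w k\<close> the difference of a fixed \<open>u m\<close> and the k-th term of the
  subsequence, a Cauchy bound passes to the limit function.\<close>

lemma L2_Fatou:
  fixes w :: "nat \<Rightarrow> 'a::euclidean_space \<Rightarrow> 'b::euclidean_space"
  assumes w: "\<And>k. w k \<in> L2 \<Omega>" and v: "v \<in> borel_measurable (lebesgue_on \<Omega>)"
    and lim: "AE x in lebesgue_on \<Omega>. (\<lambda>k. w k x) \<longlonglongrightarrow> v x"
    and bound: "\<forall>\<^sub>F k in sequentially. L2_norm \<Omega> (w k) \<le> e"
  shows "v \<in> L2 \<Omega>" "L2_norm \<Omega> v \<le> e"
proof -
  have e: "e \<ge> 0"
    using eventually_happens[OF bound] L2_norm_nonneg by (metis order_trans sequentially_bot)
  have "(\<integral>\<^sup>+x. ennreal ((norm (v x))\<^sup>2) \<partial>lebesgue_on \<Omega>)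
      = (\<integral>\<^sup>+x. liminf (\<lambda>k. ennreal ((norm (w k x))\<^sup>2)) \<partial>lebesgue_on \<Omega>)"
  proof (rule nn_integral_cong_AE, use lim in eventually_elim)
    case (elim x)
    then have "(\<lambda>k. ennreal ((norm (w k x))\<^sup>2)) \<longlonglongrightarrow> ennreal ((norm (v x))\<^sup>2)"
      by (intro tendsto_ennrealI tendsto_intros)
    then show ?case using lim_imp_Liminf[OF sequentially_bot] by metis
  qed
  also have "\<dots> \<le> liminf (\<lambda>k. \<integral>\<^sup>+x. ennreal ((norm (w k x))\<^sup>2) \<partial>lebesgue_on \<Omega>)"
    using L2_measurable[OF w] by (intro nn_integral_liminf) auto
  also have "\<dots> \<le> liminf (\<lambda>k::nat. ennreal (e\<^sup>2))"
  proof (rule Liminf_mono, use bound in eventually_elim)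
    case (elim k)
    have "(\<integral>\<^sup>+x. ennreal ((norm (w k x))\<^sup>2) \<partial>lebesgue_on \<Omega>) = ennreal ((L2_norm \<Omega> (w k))\<^sup>2)"
      unfolding L2_norm_def using L2_integrable_norm_sq[OF w[of k]]
      by (subst nn_integral_eq_integral) auto
    also have "\<dots> \<le> ennreal (e\<^sup>2)"
      using elim by (intro ennreal_leI power_mono L2_norm_nonneg)
    finally show ?case .
  qed
  finally have le: "(\<integral>\<^sup>+x. ennreal ((norm (v x))\<^sup>2) \<partial>lebesgue_on \<Omega>) \<le> ennreal (e\<^sup>2)"
    by (simp add: Liminf_const)
  have int: "integrable (lebesgue_on \<Omega>) (\<lambda>x. (norm (v x))\<^sup>2)"
    using le v by (intro integrableI_bounded) (auto intro: le_less_trans)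
  then show "v \<in> L2 \<Omega>" using v by (simp add: L2_def)
  have "ennreal (LINT x|lebesgue_on \<Omega>. (norm (v x))\<^sup>2) \<le> ennreal (e\<^sup>2)"
    using le by (subst (asm) nn_integral_eq_integral[OF int]) auto
  then have "(L2_norm \<Omega> v)\<^sup>2 \<le> e\<^sup>2" by (simp add: L2_norm_def)
  then show "L2_norm \<Omega> v \<le> e" using e by (rule power2_le_imp_le)
qed

text \<open>A fast subsequence has a pointwise limit almost everywhere. Fatou's lemma, applied along
  the subsequence with the other index fixed, gives convergence of the whole sequence in
  norm.\<close>

proposition L2_complete:
  fixes u :: "nat \<Rightarrow> 'a::euclidean_space \<Rightarrow> 'b::euclidean_space"
  assumes u: "\<And>n. u n \<in> L2 \<Omega>"
    and Cauchy: "\<And>e. e > 0 \<Longrightarrow> \<exists>N. \<forall>m\<ge>N. \<forall>n\<ge>N. L2_norm \<Omega> (\<lambda>x. u m x - u n x) < e"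
  obtains v where "v \<in> L2 \<Omega>" "(\<lambda>n. L2_norm \<Omega> (\<lambda>x. u n x - v x)) \<longlonglongrightarrow> 0"
proof -
  have "\<exists>N. \<forall>m\<ge>N. \<forall>n\<ge>N. L2_norm \<Omega> (\<lambda>x. u m x - u n x) < (1/4)^k" for k :: nat
    using Cauchy[of "(1/4)^k"] by simp
  then obtain N where N: "\<And>k m n. m \<ge> N k \<Longrightarrow> n \<ge> N k \<Longrightarrow> L2_norm \<Omega> (\<lambda>x. u m x - u n x) < (1/4)^k"
    by metis
  \<comment> \<open>The sum lies above every \<open>N i\<close> with i at most k, so both
    \<open>r k\<close> and \<open>r (Suc k)\<close> pass the threshold \<open>N k\<close>; the
    summand k makes the indices unbounded.\<close>
  define r where "r k = k + (\<Sum>i\<le>k. N i)" for k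
  have r_ge: "r k \<ge> N k" "r (Suc k) \<ge> N k" "r k \<ge> k" for k
    by (auto simp: r_def intro: order_trans[OF member_le_sum[of k "{..k}" N]])
  have conv: "AE x in lebesgue_on \<Omega>. convergent (\<lambda>k. u (r k) x)"
    using u N[OF r_ge(2) r_ge(1)] by (intro L2_fast_Cauchy_AE_convergent) (auto intro: less_imp_le)
  \<comment> \<open>On the null set where the subsequence diverges, \<open>lim\<close> is an
    unspecified value.\<close>
  define v where "v x = lim (\<lambda>k. u (r k) x)" for x
  have v_meas: "v \<in> borel_measurable (lebesgue_on \<Omega>)"
    unfolding v_def using L2_measurable[OF u] by measurable
  have key: "v \<in> L2 \<Omega> \<and> L2_norm \<Omega> (\<lambda>x. u m x - v x) \<le> e"
    if "e > 0" "\<And>k n. k \<ge> M \<Longrightarrow> n \<ge> M \<Longrightarrow> L2_norm \<Omega> (\<lambda>x. u k x - u n x) < e" "m \<ge> M" for e m M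
  proof -
    have lim: "AE x in lebesgue_on \<Omega>. (\<lambda>k. u m x - u (r k) x) \<longlonglongrightarrow> u m x - v x"
      using conv by eventually_elim (auto simp: v_def convergent_LIMSEQ_iff intro!: tendsto_intros)
    have "\<forall>\<^sub>F k in sequentially. L2_norm \<Omega> (\<lambda>x. u m x - u (r k) x) \<le> e"
      using that r_ge(3) by (intro eventually_sequentiallyI[of M]) (meson less_imp_le order_trans)
    note F = L2_Fatou[OF L2_diff[OF u u] _ lim this]
    \<comment> \<open>Fatou's lemma yields membership for \<open>u m\<close> - v, and v is recovered
      by subtracting it from \<open>u m\<close>.\<close>
    have "(\<lambda>x. u m x - (u m x - v x)) \<in> L2 \<Omega>"
      using v_meas L2_measurable[OF u] by (intro L2_diff u F(1)) auto
    moreover have "L2_norm \<Omega> (\<lambda>x. u m x - v x) \<le> e"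
      using v_meas L2_measurable[OF u] by (intro F(2)) auto
    ultimately show ?thesis by simp
  qed
  have "v \<in> L2 \<Omega>" using Cauchy[of 1] key[of 1] by (metis order_refl zero_less_one)
  moreover have "(\<lambda>n. L2_norm \<Omega> (\<lambda>x. u n x - v x)) \<longlonglongrightarrow> 0"
  proof (rule LIMSEQ_I)
    fix e :: real assume "e > 0"
    then obtain M where "\<forall>m\<ge>M. \<forall>n\<ge>M. L2_norm \<Omega> (\<lambda>x. u m x - u n x) < e/2"
      using Cauchy[of "e/2"] by auto
    then have "L2_norm \<Omega> (\<lambda>x. u m x - v x) \<le> e/2" if "m \<ge> M" for m
      using key[of "e/2" M m] that \<open>e > 0\<close> by auto
    then show "\<exists>no. \<forall>n\<ge>no. norm (L2_norm \<Omega> (\<lambda>x. u n x - v x) - 0) < e"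
      using \<open>e > 0\<close>
      by (intro exI[of _ M] allI impI) (simp add: L2_norm_nonneg le_less_trans[of _ "e / 2"])
  qed
  ultimately show ?thesis by (rule that)
qed

text \<open>A minimising sequence for the distance from G to S is Cauchy by the parallelogram law,
  and stationarity of the distance at the minimiser is the orthogonality. The assumption
  \<open>closed\<close> covers constant sequences too, so S contains every representative of its
  members.\<close>

proposition L2_orthogonal_projection:
  fixes G :: "'a::euclidean_space \<Rightarrow> 'b::euclidean_space"
  assumes S: "S \<subseteq> L2 \<Omega>" and zero: "(\<lambda>x. 0) \<in> S"
    and add: "\<And>p q. p \<in> S \<Longrightarrow> q \<in> S \<Longrightarrow> (\<lambda>x. p x + q x) \<in> S"
    and scale: "\<And>c p. p \<in> S \<Longrightarrow> (\<lambda>x. c *\<^sub>R p x) \<in> S"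
    and closed: "\<And>p q. \<lbrakk>\<And>n. p n \<in> S; q \<in> L2 \<Omega>; (\<lambda>n. L2_norm \<Omega> (\<lambda>x. p n x - q x)) \<longlonglongrightarrow> 0\<rbrakk> \<Longrightarrow> q \<in> S"
    and G: "G \<in> L2 \<Omega>"
  obtains p where "p \<in> S" "\<And>q. q \<in> S \<Longrightarrow> L2_inner \<Omega> p q = L2_inner \<Omega> G q"
proof -
  define D where "D p = (L2_norm \<Omega> (\<lambda>x. G x - p x))\<^sup>2" for p
  define d where "d = (INF p\<in>S. D p)"
  have d_le: "d \<le> D p" if "p \<in> S" for p
    unfolding d_def by (rule cINF_lower) (use that in \<open>auto intro!: bdd_belowI[of _ 0] simp: D_def\<close>)
  have "\<exists>p\<in>S. D p < d + e" if "e > 0" for e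
    using cInf_lessD[of "D ` S" "d + e"] zero that by (auto simp: d_def)
  then have "\<exists>p. p \<in> S \<and> D p < d + inverse (real (Suc n))" for n
    by (metis inverse_positive_iff_positive of_nat_0_less_iff zero_less_Suc)
  then obtain p where pS: "\<And>n. p n \<in> S" and pD: "\<And>n. D (p n) < d + inverse (real (Suc n))"
    by metis
  have pL: "p n \<in> L2 \<Omega>" for n using pS S by auto
  have parallelogram: "(L2_norm \<Omega> (\<lambda>x. p m x - p n x))\<^sup>2 \<le> 2 * (D (p m) - d) + 2 * (D (p n) - d)" for m n
  proof -
    \<comment> \<open>With these, (a + b) / 2 is G minus a midpoint in S, so the squared norm of a +
      b is at least 4 d. The parallelogram law then bounds the squared norm of a - b.\<close>
    define a where "a = (\<lambda>x. G x - p m x)"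
    define b where "b = (\<lambda>x. G x - p n x)"
    have ab: "a \<in> L2 \<Omega>" "b \<in> L2 \<Omega>" by (auto simp: a_def b_def intro!: L2_diff G pL)
    have mid: "(\<lambda>x. (1/2) *\<^sub>R (p m x + p n x)) \<in> S" by (intro scale add pS)
    have mid_eq: "D (\<lambda>x. (1/2) *\<^sub>R (p m x + p n x)) = (L2_norm \<Omega> (\<lambda>x. (1/2) *\<^sub>R (a x + b x)))\<^sup>2"
      unfolding D_def a_def b_def
      by (rule arg_cong[where f="\<lambda>u. (L2_norm \<Omega> u)\<^sup>2"]) (auto simp: algebra_simps simp flip: scaleR_add_left)
    have "4 * d \<le> 4 * (L2_norm \<Omega> (\<lambda>x. (1/2) *\<^sub>R (a x + b x)))\<^sup>2"
      using d_le[OF mid] mid_eq by simp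
    also have "\<dots> = (L2_norm \<Omega> (\<lambda>x. a x + b x))\<^sup>2"
      by (simp only: L2_norm_scale power_mult_distrib) (simp add: power2_eq_square)
    finally have "4 * d \<le> (L2_norm \<Omega> (\<lambda>x. a x + b x))\<^sup>2" .
    moreover have "(L2_norm \<Omega> (\<lambda>x. p m x - p n x))\<^sup>2 = (L2_norm \<Omega> (\<lambda>x. a x - b x))\<^sup>2"
      by (subst L2_norm_minus_commute) (simp add: a_def b_def)
    ultimately show ?thesis
      using L2_norm_sq_add[OF ab] L2_norm_sq_diff[OF ab] by (simp add: D_def a_def b_def)
  qed
  obtain q where q: "q \<in> L2 \<Omega>" "(\<lambda>n. L2_norm \<Omega> (\<lambda>x. p n x - q x)) \<longlonglongrightarrow> 0"
  proof (rule L2_complete[OF pL])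
    fix e :: real assume "e > 0"
    \<comment> \<open>Each of the two excesses over d enters the parallelogram bound twice; below
      e^2 / 4 each, they add up to less than e^2.\<close>
    then have e2: "e\<^sup>2 / 4 > 0" by simp
    then obtain N where N: "N \<noteq> 0" "inverse (real N) < e\<^sup>2 / 4" by (rule real_arch_inverse[THEN iffD1, THEN exE]) auto
    have small: "inverse (real (Suc n)) < e\<^sup>2 / 4" if "n \<ge> N" for n
      using N that by (intro le_less_trans[OF le_imp_inverse_le[of "real N" "real (Suc n)"] N(2)]) auto
    have "L2_norm \<Omega> (\<lambda>x. p m x - p n x) < e" if "m \<ge> N" "n \<ge> N" for m n
    proof (rule power2_less_imp_less)
      show "(L2_norm \<Omega> (\<lambda>x. p m x - p n x))\<^sup>2 < e\<^sup>2"
      proof (rule le_less_trans[OF parallelogram])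
        show "2 * (D (p m) - d) + 2 * (D (p n) - d) < e\<^sup>2"
          using less_trans[OF pD add_strict_left_mono[OF small[OF that(1)]]]
            less_trans[OF pD add_strict_left_mono[OF small[OF that(2)]]] by argo
      qed
    qed (use \<open>e > 0\<close> in simp)
    then show "\<exists>N. \<forall>m\<ge>N. \<forall>n\<ge>N. L2_norm \<Omega> (\<lambda>x. p m x - p n x) < e" by blast
  qed
  have qS: "q \<in> S" using closed[OF pS q] .
  \<comment> \<open>By the triangle inequality through \<open>p n\<close>, the distance from G to q
    is at most a sequence that tends to the square root of d.\<close>
  have "D q \<le> d"
  proof (rule LIMSEQ_le_const)
    have lim1: "(\<lambda>n. sqrt (d + inverse (real (Suc n))) + L2_norm \<Omega> (\<lambda>x. p n x - q x)) \<longlonglongrightarrow> sqrt (d + 0) + 0"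
      by (intro tendsto_intros q(2) LIMSEQ_inverse_real_of_nat)
    have "d \<ge> 0" unfolding d_def by (rule cINF_greatest) (use zero in \<open>auto simp: D_def\<close>)
    then show "(\<lambda>n. (sqrt (d + inverse (real (Suc n))) + L2_norm \<Omega> (\<lambda>x. p n x - q x))\<^sup>2) \<longlonglongrightarrow> d"
      using tendsto_power[OF lim1, of 2] by simp
    have "D q \<le> (sqrt (d + inverse (real (Suc n))) + L2_norm \<Omega> (\<lambda>x. p n x - q x))\<^sup>2" for n
      unfolding D_def
    proof (rule power_mono[OF _ L2_norm_nonneg])
      have "L2_norm \<Omega> (\<lambda>x. G x - q x) \<le> L2_norm \<Omega> (\<lambda>x. G x - p n x) + L2_norm \<Omega> (\<lambda>x. p n x - q x)"
        by (rule L2_dist_triangle[OF G pL q(1)])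
      moreover have "L2_norm \<Omega> (\<lambda>x. G x - p n x) \<le> sqrt (d + inverse (real (Suc n)))"
        using pD[of n] by (intro real_le_rsqrt) (simp add: D_def)
      ultimately show "L2_norm \<Omega> (\<lambda>x. G x - q x) \<le> sqrt (d + inverse (real (Suc n))) + L2_norm \<Omega> (\<lambda>x. p n x - q x)"
        by simp
    qed
    then show "\<exists>N. \<forall>n\<ge>N. D q \<le> (sqrt (d + inverse (real (Suc n))) + L2_norm \<Omega> (\<lambda>x. p n x - q x))\<^sup>2"
      by blast
  qed
  have "L2_inner \<Omega> q h = L2_inner \<Omega> G h" if "h \<in> S" for h
  proof -
    have hL: "h \<in> L2 \<Omega>" using that S by auto
    define b c where "b = L2_inner \<Omega> (\<lambda>x. G x - q x) h" and "c = (L2_norm \<Omega> h)\<^sup>2"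
    \<comment> \<open>q + t h stays in S, so moving along h cannot decrease the squared
      distance.\<close>
    have quad: "0 \<le> - 2 * t * b + t\<^sup>2 * c" for t
    proof -
      have "(\<lambda>x. q x + t *\<^sub>R h x) \<in> S" by (intro add scale qS that)
      from d_le[OF this] have "D q \<le> (L2_norm \<Omega> (\<lambda>x. (G x - q x) - t *\<^sub>R h x))\<^sup>2"
        using \<open>D q \<le> d\<close> by (simp add: D_def algebra_simps)
      then show ?thesis
        by (subst (asm) L2_norm_sq_diff[OF L2_diff[OF G q(1)] L2_scale[OF hL]])
           (simp add: D_def b_def c_def L2_norm_scale power_mult_distrib
              L2_inner_commute[of _ "\<lambda>x. G x - q x"] L2_inner_scale_left)
    qed
    have "b = 0"
    proof (rule ccontr)
      assume "b \<noteq> 0"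
      \<comment> \<open>The choice t = b / (c + 1) instead of the minimiser b / c also covers c =
        0.\<close>
      have "c + 1 > 0" by (simp add: c_def add_nonneg_pos)
      then have "- 2 * (b / (c + 1)) * b + (b / (c + 1))\<^sup>2 * c = - (b\<^sup>2 * (c + 2)) / (c + 1)\<^sup>2"
        by (simp add: divide_simps power2_eq_square) (simp add: algebra_simps)
      also have "\<dots> < 0"
        using \<open>b \<noteq> 0\<close> \<open>c + 1 > 0\<close> by (intro divide_neg_pos) auto
      finally show False using quad[of "b / (c + 1)"] by simp
    qed
    then show ?thesis using hL G q(1) by (simp add: b_def L2_inner_diff_left)
  qed
  then show ?thesis using qS that by blast
qed

section \<open>Smooth bump functions\<close>

text \<open>For m = 0 this is the classical smooth function exp(-1/t) extended by zero.
  Differentiation produces powers of 1/t; carrying the exponent m as an index makes the span of the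
  family closed under it.\<close>

definition flat :: "nat \<Rightarrow> real \<Rightarrow> real" where
  "flat m t = (if t > 0 then exp (- (1 / t)) / t ^ m else 0)"

text \<open>This quotient is the difference quotient at 0, where \<open>flat\<close> vanishes. From
  the right, h = 1/y turns it into a power of y divided by exp y.\<close>

lemma flat_div_tendsto_0: "((\<lambda>h. flat m h / h) \<longlongrightarrow> 0) (at 0)"
proof (rule filterlim_split_at)
  have "\<forall>\<^sub>F h :: real in at_left 0. flat m h / h = 0"
    by (auto simp: flat_def eventually_at_left_field intro: exI[of _ "-1"])
  then show "((\<lambda>h. flat m h / h) \<longlongrightarrow> 0) (at_left 0)"
    by (rule tendsto_eventually)
  have "((\<lambda>y::real. y ^ Suc m / exp y) \<longlongrightarrow> 0) at_top"
    by (rule tendsto_power_div_exp_0)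
  moreover have "\<forall>\<^sub>F y in at_top. y ^ Suc m / exp y = flat m (inverse y) / inverse y"
    using eventually_gt_at_top[of 0]
    by eventually_elim (simp add: flat_def exp_minus field_simps)
  ultimately have "((\<lambda>y. flat m (inverse y) / inverse y) \<longlongrightarrow> 0) at_top"
    by (rule Lim_transform_eventually)
  then show "((\<lambda>h. flat m h / h) \<longlongrightarrow> 0) (at_right 0)"
    by (simp add: filterlim_at_right_to_top)
qed

lemma flat_has_derivative:
  "(flat m has_real_derivative flat (Suc (Suc m)) t - real m * flat (Suc m) t) (at t)"
proof (cases t "0::real" rule: linorder_cases)
  case less
  have "((\<lambda>_. 0) has_real_derivative 0) (at t)" by simp
  then have "(flat m has_real_derivative 0) (at t)"
    by (rule DERIV_cong_ev[OF refl _ refl, THEN iffD1, rotated])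
       (use less in \<open>auto simp: flat_def eventually_nhds intro!: exI[of _ "{..<0}"]\<close>)
  then show ?thesis using less by (simp add: flat_def)
next
  case equal
  then show ?thesis
    using flat_div_tendsto_0[of m] by (simp add: DERIV_def) (simp add: flat_def)
next
  case greater
  have "((\<lambda>t. exp (- (1 / t)) / t ^ m) has_real_derivative
      flat (Suc (Suc m)) t - real m * flat (Suc m) t) (at t)"
  proof (cases m)
    case 0
    then show ?thesis
      using greater by (auto intro!: derivative_eq_intros simp: flat_def field_simps power2_eq_square)
  next
    case (Suc k)
    have "((\<lambda>t. exp (- (1 / t)) / t ^ Suc k) has_real_derivative
        (exp (- (1 / t)) * (1 / t\<^sup>2) * t ^ Suc k - exp (- (1 / t)) * (real (Suc k) * t ^ k)) / (t ^ Suc k)\<^sup>2) (at t)"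
      using greater
      by (auto intro!: derivative_eq_intros simp: power2_eq_square simp del: power_Suc)
    also have "(exp (- (1 / t)) * (1 / t\<^sup>2) * t ^ Suc k - exp (- (1 / t)) * (real (Suc k) * t ^ k)) / (t ^ Suc k)\<^sup>2
        = flat (Suc (Suc m)) t - real m * flat (Suc m) t"
      using greater by (simp add: Suc flat_def field_simps power2_eq_square del: of_nat_Suc)
    finally show ?thesis by (simp only: Suc)
  qed
  then show ?thesis
    by (rule DERIV_cong_ev[OF refl _ refl, THEN iffD1, rotated])
       (use greater in \<open>auto simp: flat_def eventually_nhds intro!: exI[of _ "{0<..}"]\<close>)
qed

text \<open>An algebra of functions that contains bumps and is closed under partial derivatives; all its
  members are therefore smooth.\<close>

inductive_set flat_algebra :: "('a::euclidean_space \<Rightarrow> real) set" where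
  const: "(\<lambda>x. c) \<in> flat_algebra"
| flat: "(\<lambda>x. flat m (x \<bullet> v + c)) \<in> flat_algebra"
| add: "\<phi> \<in> flat_algebra \<Longrightarrow> \<psi> \<in> flat_algebra \<Longrightarrow> (\<lambda>x. \<phi> x + \<psi> x) \<in> flat_algebra"
| mult: "\<phi> \<in> flat_algebra \<Longrightarrow> \<psi> \<in> flat_algebra \<Longrightarrow> (\<lambda>x. \<phi> x * \<psi> x) \<in> flat_algebra"

lemma flat_algebra_has_derivative:
  assumes "\<phi> \<in> flat_algebra"
  shows "\<exists>D. (\<forall>x. (\<phi> has_derivative D x) (at x)) \<and> (\<forall>b. (\<lambda>x. D x b) \<in> flat_algebra)"
  using assms
proof induction
  case (const c)
  show ?case by (intro exI[of _ "\<lambda>x h. 0"]) (auto intro: flat_algebra.intros)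
next
  case (flat m v c)
  let ?f = "\<lambda>x. flat (Suc (Suc m)) (x \<bullet> v + c) - real m * flat (Suc m) (x \<bullet> v + c)"
  show ?case
  proof (intro exI[of _ "\<lambda>x h. ?f x * (h \<bullet> v)"] conjI allI)
    fix x
    have "((\<lambda>x. x \<bullet> v + c) has_derivative (\<lambda>h. h \<bullet> v)) (at x)"
      by (auto intro!: derivative_eq_intros)
    from has_derivative_compose[OF this flat_has_derivative[of m, unfolded has_field_derivative_def]]
    show "((\<lambda>x. flat m (x \<bullet> v + c)) has_derivative (\<lambda>h. ?f x * (h \<bullet> v))) (at x)" .
  next
    fix b
    have "(\<lambda>x. (flat (Suc (Suc m)) (x \<bullet> v + c) + (- real m) * flat (Suc m) (x \<bullet> v + c)) * (b \<bullet> v))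
        \<in> flat_algebra"
      by (intro flat_algebra.intros)
    then show "(\<lambda>x. ?f x * (b \<bullet> v)) \<in> flat_algebra" by simp
  qed
next
  case (add \<phi> \<psi>)
  then obtain D E where "\<forall>x. (\<phi> has_derivative D x) (at x)" "\<forall>b. (\<lambda>x. D x b) \<in> flat_algebra"
    "\<forall>x. (\<psi> has_derivative E x) (at x)" "\<forall>b. (\<lambda>x. E x b) \<in> flat_algebra" by blast
  then show ?case
    by (intro exI[of _ "\<lambda>x h. D x h + E x h"]) (auto intro: flat_algebra.intros has_derivative_add)
next
  case (mult \<phi> \<psi>)
  then obtain D E where "\<forall>x. (\<phi> has_derivative D x) (at x)" "\<forall>b. (\<lambda>x. D x b) \<in> flat_algebra"
    "\<forall>x. (\<psi> has_derivative E x) (at x)" "\<forall>b. (\<lambda>x. E x b) \<in> flat_algebra" by blast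
  then show ?case using mult.hyps
    by (intro exI[of _ "\<lambda>x h. \<phi> x * E x h + D x h * \<psi> x"])
       (auto intro!: flat_algebra.add flat_algebra.mult has_derivative_mult)
qed

lemma flat_algebra_smooth: "\<phi> \<in> flat_algebra \<Longrightarrow> k_times_cont_diff k \<phi>"
proof (induction k arbitrary: \<phi>)
  case 0
  then obtain D where "\<forall>x. (\<phi> has_derivative D x) (at x)" using flat_algebra_has_derivative by blast
  then show ?case
    by (auto intro!: continuous_at_imp_continuous_on has_derivative_continuous)
next
  case (Suc k)
  then obtain D where D: "\<forall>x. (\<phi> has_derivative D x) (at x)" "\<forall>b. (\<lambda>x. D x b) \<in> flat_algebra"
    using flat_algebra_has_derivative by blast
  then have "partial_deriv b \<phi> = (\<lambda>x. D x b)" for b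
    unfolding partial_deriv_def by (metis frechet_derivative_at)
  then show ?case
    using D Suc.IH by (auto simp: differentiable_on_def differentiable_def intro: has_derivative_at_withinI)
qed

text \<open>For t > 0 the factor \<open>flat 0\<close> at (n + 1) t is exp(-1 / ((n + 1) t)), which
  tends to 1; for t at most 0 it vanishes. The arguments are the scaled signed distances to the
  faces of the box.\<close>

definition box_bump :: "'a::euclidean_space \<Rightarrow> 'a \<Rightarrow> nat \<Rightarrow> 'a \<Rightarrow> real" where
  "box_bump a b n x =
    (\<Prod>i\<in>Basis. flat 0 (real (Suc n) * ((x - a) \<bullet> i)) * flat 0 (real (Suc n) * ((b - x) \<bullet> i)))"

lemma box_bump_in_flat_algebra: "box_bump a b n \<in> flat_algebra"
proof -
  have prod: "(\<lambda>x. \<Prod>i\<in>I. \<phi> i x) \<in> flat_algebra" if "finite I" "\<And>i. \<phi> i \<in> flat_algebra"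
    for I and \<phi> :: "'a \<Rightarrow> 'a \<Rightarrow> real"
    using that by (induction I) (auto intro: flat_algebra.intros)
  \<comment> \<open>The scaled distances to the two opposite faces, written in the affine form that
    the generators of \<open>flat_algebra\<close> accept.\<close>
  have "(\<lambda>x. flat 0 (x \<bullet> (real (Suc n) *\<^sub>R i) + - (real (Suc n) * (a \<bullet> i))) *
      flat 0 (x \<bullet> (- real (Suc n) *\<^sub>R i) + real (Suc n) * (b \<bullet> i))) \<in> flat_algebra" for i
    by (intro flat_algebra.intros)
  also have "(\<lambda>x. flat 0 (x \<bullet> (real (Suc n) *\<^sub>R i) + - (real (Suc n) * (a \<bullet> i))) *
      flat 0 (x \<bullet> (- real (Suc n) *\<^sub>R i) + real (Suc n) * (b \<bullet> i)))
    = (\<lambda>x. flat 0 (real (Suc n) * ((x - a) \<bullet> i)) * flat 0 (real (Suc n) * ((b - x) \<bullet> i)))" for i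
    by (simp only: inner_diff_left inner_scaleR_right right_diff_distrib) (simp add: algebra_simps)
  finally show ?thesis
    unfolding box_bump_def[abs_def] by (intro prod) auto
qed

lemma box_bump_outside: "x \<notin> box a b \<Longrightarrow> box_bump a b n x = 0"
proof -
  assume "x \<notin> box a b"
  then obtain i where i: "i \<in> Basis" "(x - a) \<bullet> i \<le> 0 \<or> (b - x) \<bullet> i \<le> 0"
    by (auto simp: mem_box inner_diff_left not_less)
  have "flat 0 (real (Suc n) * t) = 0" if "t \<le> 0" for t
    using that by (simp add: flat_def zero_less_mult_iff del: of_nat_Suc)
  with i show ?thesis
    unfolding box_bump_def by (intro prod_zero bexI[of _ i]) auto
qed

lemma box_bump_bounds: "0 \<le> box_bump a b n x" "box_bump a b n x \<le> 1"
  unfolding box_bump_def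
  by (auto intro!: prod_nonneg prod_le_1 mult_le_one simp: flat_def)

lemma box_bump_test_function:
  assumes "cbox a b \<subseteq> \<Omega>"
  shows "box_bump a b n \<in> test_functions \<Omega>"
proof -
  have "closure {x. box_bump a b n x \<noteq> 0} \<subseteq> cbox a b"
  proof (rule closure_minimal)
    show "{x. box_bump a b n x \<noteq> 0} \<subseteq> cbox a b"
      using box_bump_outside box_subset_cbox[of a b] by blast
  qed (rule closed_cbox)
  moreover from this have "compact (closure {x. box_bump a b n x \<noteq> 0})"
    by (metis bounded_cbox bounded_subset closed_closure compact_eq_bounded_closed)
  ultimately show ?thesis
    using assms flat_algebra_smooth[OF box_bump_in_flat_algebra] by (auto simp: test_functions_def)
qed

lemma box_bump_tendsto_indicator: "(\<lambda>n. box_bump a b n x) \<longlonglongrightarrow> indicator (box a b) x"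
proof (cases "x \<in> box a b")
  case True
  have lim: "(\<lambda>n. flat 0 (real (Suc n) * t)) \<longlonglongrightarrow> 1" if "t > 0" for t
  proof -
    have "(\<lambda>n. exp (- (inverse (real (Suc n)) * inverse t))) \<longlonglongrightarrow> exp (- (0 * inverse t))"
      by (intro tendsto_intros LIMSEQ_inverse_real_of_nat)
    moreover have "exp (- (inverse (real (Suc n)) * inverse t)) = flat 0 (real (Suc n) * t)" for n
      using that by (simp add: flat_def inverse_eq_divide)
    ultimately show ?thesis by simp
  qed
  have "(\<lambda>n. box_bump a b n x) \<longlonglongrightarrow> (\<Prod>i\<in>(Basis::'a set). 1 * 1)"
    unfolding box_bump_def
    by (intro tendsto_intros lim) (use True in \<open>auto simp: mem_box inner_diff_left\<close>)
  then show ?thesis using True by simp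
qed (simp add: box_bump_outside)

section \<open>Integration by parts\<close>

lemma lborel_integral_translate:
  fixes h :: "'a::euclidean_space \<Rightarrow> real"
  assumes "h \<in> borel_measurable borel"
  shows "(LINT x|lborel. h (x + c)) = (LINT x|lborel. h x)"
proof -
  have "(LINT x|distr lborel borel ((+) c). h x) = (LINT x|lborel. h (c + x))"
    using assms by (intro integral_distr) auto
  then show ?thesis by (simp add: lborel_distr_plus add.commute)
qed

lemma integrable_compact_support:
  fixes h :: "'a::euclidean_space \<Rightarrow> real"
  assumes cont: "continuous_on UNIV h" and K: "compact K" and supp: "\<And>x. x \<notin> K \<Longrightarrow> h x = 0"
  shows "integrable lborel h"
proof -
  have "compact (h ` K)"
    using K cont by (intro compact_continuous_image) (auto intro: continuous_on_subset)
  then obtain B where B: "\<And>x. x \<in> K \<Longrightarrow> norm (h x) \<le> B"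
    by (meson bounded_iff compact_imp_bounded imageI)
  show ?thesis
  proof (rule Bochner_Integration.integrable_bound)
    show "integrable lborel (\<lambda>x. indicator K x *\<^sub>R B)"
      using emeasure_compact_finite[OF K] K
      by (intro integrable_scaleR_left integrable_real_indicator) (auto simp: compact_imp_closed)
    show "AE x in lborel. norm (h x) \<le> norm (indicator K x *\<^sub>R B)"
      using B supp by (intro AE_I2) (force simp: indicator_def)
  qed (use cont in \<open>simp add: borel_measurable_continuous_onI\<close>)
qed

lemma line_has_derivative:
  fixes h :: "'a::euclidean_space \<Rightarrow> real"
  assumes "h differentiable_on UNIV"
  shows "((\<lambda>s. h (x + s *\<^sub>R b)) has_real_derivative partial_deriv b h (x + s *\<^sub>R b)) (at s)"
proof -
  let ?D = "frechet_derivative h (at (x + s *\<^sub>R b))"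
  have D: "(h has_derivative ?D) (at (x + s *\<^sub>R b))"
    using assms by (simp add: differentiable_on_def frechet_derivative_works)
  have "((\<lambda>s. x + s *\<^sub>R b) has_derivative (\<lambda>t. t *\<^sub>R b)) (at s)"
    by (auto intro!: derivative_eq_intros)
  from has_derivative_compose[OF this D]
  have "((\<lambda>s. h (x + s *\<^sub>R b)) has_derivative (\<lambda>t. ?D (t *\<^sub>R b))) (at s)" .
  moreover have "?D (t *\<^sub>R b) = partial_deriv b h (x + s *\<^sub>R b) * t" for t
    using has_derivative_linear[OF D] by (simp add: partial_deriv_def linear_cmul)
  ultimately show ?thesis by (simp add: has_field_derivative_def)
qed

text \<open>Closedness of K makes h vanish in a whole neighbourhood of x.\<close>

lemma partial_deriv_zero_outside:
  fixes h :: "'a::euclidean_space \<Rightarrow> real"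
  assumes "closed K" and "\<And>x. x \<notin> K \<Longrightarrow> h x = 0" and "x \<notin> K"
  shows "partial_deriv b h x = 0"
proof -
  have "(h has_derivative (\<lambda>_. 0)) (at x)"
    by (rule has_derivative_transform_within_open[of "\<lambda>_. 0" _ _ _ "- K"]) (use assms in auto)
  from frechet_derivative_at[OF this] show ?thesis by (metis partial_deriv_def)
qed

text \<open>The derivative is the limit of difference quotients, which integrate to zero by translation
  invariance.\<close>

lemma integral_partial_deriv_eq_0:
  fixes h :: "'a::euclidean_space \<Rightarrow> real"
  assumes diff: "h differentiable_on UNIV" and cont: "continuous_on UNIV (partial_deriv b h)"
    and K: "compact K" and supp: "\<And>x. x \<notin> K \<Longrightarrow> h x = 0"
  shows "(LINT x|lborel. partial_deriv b h x) = 0"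
proof -
  define t where "t n = inverse (real (Suc n))" for n
  have t: "t n > 0" "t n \<le> 1" for n by (auto simp: t_def inverse_eq_divide)
  define D where "D n x = (h (x + t n *\<^sub>R b) - h x) / t n" for n x
  have h_cont: "continuous_on UNIV h"
    using diff by (rule differentiable_imp_continuous_on)
  have h_int: "integrable lborel h"
    using h_cont K supp by (rule integrable_compact_support)
  have h_meas: "h \<in> borel_measurable borel" using h_cont by (rule borel_measurable_continuous_onI)
  have supp': "partial_deriv b h x = 0" if "x \<notin> K" for x
    using partial_deriv_zero_outside[OF compact_imp_closed[OF K]] supp that by blast
  have "compact (partial_deriv b h ` K)"
    using K cont by (intro compact_continuous_image) (auto intro: continuous_on_subset)
  then obtain B0 where B0: "\<And>x. x \<in> K \<Longrightarrow> norm (partial_deriv b h x) \<le> B0"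
    by (meson bounded_iff compact_imp_bounded imageI)
  \<comment> \<open>\<open>B0\<close> is a bound on K only, and could be negative for empty K;
    outside K the derivative is 0.\<close>
  define B where "B = max B0 0"
  have B: "\<bar>partial_deriv b h x\<bar> \<le> B" for x
    using B0[of x] supp'[of x] by (cases "x \<in> K") (auto simp: B_def)
  obtain R where R: "\<And>x. x \<in> K \<Longrightarrow> norm x \<le> R"
    using compact_imp_bounded[OF K] by (auto simp: bounded_iff)
  \<comment> \<open>Since \<open>t n\<close> is at most 1, this ball contains K and all its
    translates by - \<open>t n\<close> b. Hence every \<open>D n\<close> vanishes outside it, and by
    the mean value theorem B dominates \<open>D n\<close> inside.\<close>
  let ?C = "cball (0::'a) (R + norm b)"
  have mvt: "\<exists>s. D n x = partial_deriv b h (x + s *\<^sub>R b)" for n x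
  proof -
    have "\<exists>s. 0 < s \<and> s < t n \<and>
        h (x + t n *\<^sub>R b) - h (x + 0 *\<^sub>R b) = (t n - 0) * partial_deriv b h (x + s *\<^sub>R b)"
      by (rule MVT2[OF t(1)]) (use line_has_derivative[OF diff] in auto)
    then show ?thesis using t(1)[of n] by (auto simp: D_def field_simps)
  qed
  have "(\<lambda>n. LINT x|lborel. D n x) \<longlonglongrightarrow> (LINT x|lborel. partial_deriv b h x)"
  proof (rule integral_dominated_convergence)
    show "integrable lborel (\<lambda>x. indicator ?C x *\<^sub>R B)"
      using emeasure_lborel_cball_finite[of "0::'a" "R + norm b"]
      by (intro integrable_scaleR_left integrable_real_indicator) auto
    show "AE x in lborel. (\<lambda>n. D n x) \<longlonglongrightarrow> partial_deriv b h x"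
    proof (intro AE_I2)
      fix x
      have "((\<lambda>s. (h (x + s *\<^sub>R b) - h x) / s) \<longlongrightarrow> partial_deriv b h x) (at 0)"
        using line_has_derivative[OF diff, of x b 0] by (simp add: DERIV_def)
      moreover have "filterlim t (at 0) sequentially"
        unfolding filterlim_at t_def[abs_def] by (simp add: LIMSEQ_inverse_real_of_nat del: of_nat_Suc)
      ultimately show "(\<lambda>n. D n x) \<longlonglongrightarrow> partial_deriv b h x"
        unfolding D_def by (rule filterlim_compose)
    qed
    show "AE x in lborel. norm (D n x) \<le> indicator ?C x *\<^sub>R B" for n
    proof (intro AE_I2)
      fix x
      show "norm (D n x) \<le> indicator ?C x *\<^sub>R B"
      proof (cases "x \<in> ?C")
        case True
        then show ?thesis using mvt[of n x] B by auto
      next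
        case False
        have "x \<notin> K"
        proof
          assume "x \<in> K"
          then have "norm x \<le> R + norm b" using R[of x] norm_ge_zero[of b] by linarith
          then show False using False by simp
        qed
        moreover have "x + t n *\<^sub>R b \<notin> K"
        proof
          assume "x + t n *\<^sub>R b \<in> K"
          then have "norm (x + t n *\<^sub>R b) \<le> R" by (rule R)
          moreover have "norm (t n *\<^sub>R b) \<le> norm b"
            using t[of n] by (simp add: mult_left_le_one_le)
          moreover have "norm x \<le> norm (x + t n *\<^sub>R b) + norm (t n *\<^sub>R b)"
            using norm_triangle_ineq4[of "x + t n *\<^sub>R b" "t n *\<^sub>R b"] by simp
          ultimately show False using False by simp
        qed
        ultimately show ?thesis using False by (simp add: D_def supp)
      qed
    qed
    show "D n \<in> borel_measurable lborel" for n
      unfolding D_def using h_meas by measurable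
  qed (use cont in \<open>simp add: borel_measurable_continuous_onI\<close>)
  moreover have "(LINT x|lborel. D n x) = 0" for n
  proof -
    have "continuous_on UNIV (\<lambda>x. h (x + t n *\<^sub>R b))"
      by (intro continuous_on_compose2[OF h_cont] continuous_intros) auto
    moreover have "compact ((\<lambda>x. x - t n *\<^sub>R b) ` K)"
      using K by (intro compact_continuous_image continuous_intros)
    moreover have "h (x + t n *\<^sub>R b) = 0" if "x \<notin> (\<lambda>x. x - t n *\<^sub>R b) ` K" for x
      using that by (intro supp) (auto simp: image_iff)
    ultimately have "integrable lborel (\<lambda>x. h (x + t n *\<^sub>R b))"
      by (rule integrable_compact_support)
    then show ?thesis
      unfolding D_def using h_int lborel_integral_translate[OF h_meas, of "t n *\<^sub>R b"] by simp
  qed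
  ultimately show ?thesis by (simp add: LIMSEQ_const_iff)
qed

section \<open>Test functions: supports, square integrability, integration by parts\<close>

lemma test_functionD:
  assumes "\<phi> \<in> test_functions \<Omega>"
  shows "\<phi> differentiable_on UNIV" "continuous_on UNIV \<phi>"
    and "b \<in> Basis \<Longrightarrow> continuous_on UNIV (partial_deriv b \<phi>)"
proof -
  have "k_times_cont_diff (Suc 0) \<phi>" "k_times_cont_diff 0 \<phi>"
    using assms unfolding test_functions_def by blast+
  then show "\<phi> differentiable_on UNIV" "continuous_on UNIV \<phi>"
    and "b \<in> Basis \<Longrightarrow> continuous_on UNIV (partial_deriv b \<phi>)"
    by auto
qed

lemma test_function_support:
  assumes "\<phi> \<in> test_functions \<Omega>"
  obtains K where "compact K" "K \<subseteq> \<Omega>" "\<And>x. x \<notin> K \<Longrightarrow> \<phi> x = 0"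
    "\<And>x b. x \<notin> K \<Longrightarrow> partial_deriv b \<phi> x = 0"
proof
  let ?K = "closure {x. \<phi> x \<noteq> 0}"
  show "compact ?K" "?K \<subseteq> \<Omega>"
    using assms unfolding test_functions_def by blast+
  show zero: "\<phi> x = 0" if "x \<notin> ?K" for x
    using that closure_subset[of "{x. \<phi> x \<noteq> 0}"] by blast
  show "partial_deriv b \<phi> x = 0" if "x \<notin> ?K" for x b
    by (rule partial_deriv_zero_outside[OF closed_closure zero that])
qed

text \<open>Translation invariance is a statement about the whole space, whereas weak gradients are
  defined by integrals over \<Omega>; functions vanishing outside \<Omega> pass between the
  two.\<close>

lemma integral_lebesgue_on_eq_lborel:
  fixes F :: "'a::euclidean_space \<Rightarrow> real"
  assumes "\<Omega> \<in> sets lebesgue" "F \<in> borel_measurable borel" "\<And>x. x \<notin> \<Omega> \<Longrightarrow> F x = 0"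
  shows "(LINT x|lebesgue_on \<Omega>. F x) = (LINT x|lborel. F x)"
proof -
  have "(LINT x|lebesgue_on \<Omega>. F x) = (LINT x|lebesgue. indicator \<Omega> x *\<^sub>R F x)"
    using assms by (intro integral_restrict_space) auto
  also have "(\<lambda>x. indicator \<Omega> x *\<^sub>R F x) = F"
    using assms(3) by (fastforce simp: indicator_def fun_eq_iff)
  finally show ?thesis using assms(2) by (simp add: integral_completion)
qed

lemma L2_compact_support:
  fixes g :: "'a::euclidean_space \<Rightarrow> 'b::euclidean_space"
  assumes \<Omega>: "\<Omega> \<in> sets lebesgue" and cont: "continuous_on UNIV g"
    and K: "compact K" and supp: "\<And>x. x \<notin> K \<Longrightarrow> g x = 0"
  shows "g \<in> L2 \<Omega>"
proof -
  have "continuous_on UNIV (\<lambda>x. (norm (g x))\<^sup>2)"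
    using cont by (intro continuous_intros)
  then have "integrable lborel (\<lambda>x. (norm (g x))\<^sup>2)"
    using K supp by (intro integrable_compact_support[of _ K]) auto
  then have "integrable lebesgue (\<lambda>x. (norm (g x))\<^sup>2)"
    using cont by (simp add: integrable_completion borel_measurable_continuous_onI)
  then have "integrable (lebesgue_on \<Omega>) (\<lambda>x. (norm (g x))\<^sup>2)"
    using integrable_mult_indicator[of \<Omega> lebesgue "\<lambda>x. (norm (g x))\<^sup>2"] \<Omega>
    by (subst integrable_restrict_space) simp_all
  moreover have "g \<in> borel_measurable (lebesgue_on \<Omega>)"
    using cont \<Omega> by (intro continuous_imp_measurable_on_sets_lebesgue) (auto intro: continuous_on_subset)
  ultimately show ?thesis by (simp add: L2_def)
qed

lemma test_function_L2:
  assumes "\<Omega> \<in> sets lebesgue" "\<phi> \<in> test_functions \<Omega>"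
  shows "\<phi> \<in> L2 \<Omega>" and "b \<in> Basis \<Longrightarrow> partial_deriv b \<phi> \<in> L2 \<Omega>"
proof -
  obtain K where "compact K" "K \<subseteq> \<Omega>" "\<And>x. x \<notin> K \<Longrightarrow> \<phi> x = 0"
    "\<And>x b. x \<notin> K \<Longrightarrow> partial_deriv b \<phi> x = 0"
    by (rule test_function_support[OF assms(2)]) (rule that)
  then show "\<phi> \<in> L2 \<Omega>" and "b \<in> Basis \<Longrightarrow> partial_deriv b \<phi> \<in> L2 \<Omega>"
    using test_functionD[OF assms(2)] by (auto intro!: L2_compact_support[OF assms(1)])
qed

text \<open>The product of the two functions is differentiable with compact support, so its partial
  derivative integrates to zero; the product rule splits this integral.\<close>

lemma test_function_integration_by_parts:
  assumes \<Omega>: "\<Omega> \<in> sets lebesgue" and \<phi>: "\<phi> \<in> test_functions \<Omega>" and \<psi>: "\<psi> \<in> test_functions \<Omega>"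
    and b: "b \<in> Basis"
  shows "(LINT x|lebesgue_on \<Omega>. \<phi> x * partial_deriv b \<psi> x)
    = - (LINT x|lebesgue_on \<Omega>. partial_deriv b \<phi> x * \<psi> x)"
proof -
  note P = test_functionD[OF \<phi>] and Q = test_functionD[OF \<psi>]
  obtain K where K: "compact K" "K \<subseteq> \<Omega>" "\<And>x. x \<notin> K \<Longrightarrow> \<phi> x = 0"
    "\<And>x b. x \<notin> K \<Longrightarrow> partial_deriv b \<phi> x = 0"
    by (rule test_function_support[OF \<phi>]) (rule that)
  let ?h = "\<lambda>x. \<phi> x * \<psi> x"
  have D: "(?h has_derivative
      (\<lambda>t. \<phi> x * frechet_derivative \<psi> (at x) t + frechet_derivative \<phi> (at x) t * \<psi> x)) (at x)" for x
    using P(1) Q(1)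
    by (intro has_derivative_mult) (auto simp: differentiable_on_def frechet_derivative_works[symmetric])
  then have pd: "partial_deriv b ?h = (\<lambda>x. \<phi> x * partial_deriv b \<psi> x + partial_deriv b \<phi> x * \<psi> x)"
    by (auto simp: partial_deriv_def fun_eq_iff simp flip: frechet_derivative_at[OF D])
  have cont: "continuous_on UNIV (partial_deriv b ?h)"
    unfolding pd using P(2,3) Q(2,3) b by (intro continuous_intros)
  have "(LINT x|lborel. partial_deriv b ?h x) = 0"
  proof (rule integral_partial_deriv_eq_0[OF _ cont K(1)])
    show "?h differentiable_on UNIV"
      using D by (auto simp: differentiable_on_def differentiable_def intro: has_derivative_at_withinI)
  qed (simp add: K(3))
  also have "(LINT x|lborel. partial_deriv b ?h x) = (LINT x|lebesgue_on \<Omega>. partial_deriv b ?h x)"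
  proof (rule integral_lebesgue_on_eq_lborel[OF \<Omega>, symmetric])
    show "partial_deriv b ?h \<in> borel_measurable borel"
      using cont by (rule borel_measurable_continuous_onI)
    show "partial_deriv b ?h x = 0" if "x \<notin> \<Omega>" for x
    proof -
      have "x \<notin> K" using that K(2) by blast
      then show ?thesis by (simp add: pd K(3,4))
    qed
  qed
  also have "\<dots> = (LINT x|lebesgue_on \<Omega>. \<phi> x * partial_deriv b \<psi> x)
      + (LINT x|lebesgue_on \<Omega>. partial_deriv b \<phi> x * \<psi> x)"
    unfolding pd
    using L2_integrable_inner[OF test_function_L2(1)[OF \<Omega> \<phi>] test_function_L2(2)[OF \<Omega> \<psi> b]]
      L2_integrable_inner[OF test_function_L2(2)[OF \<Omega> \<phi> b] test_function_L2(1)[OF \<Omega> \<psi>]]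
    by simp
  finally show ?thesis by simp
qed

text \<open>By integration by parts the classical gradient is a weak one. The membership gives
  access to the energy norm triangle inequality for approximating test functions.\<close>

lemma test_functions_subset_H1:
  assumes \<Omega>: "\<Omega> \<in> sets lebesgue" and \<phi>: "\<phi> \<in> test_functions \<Omega>"
  shows "\<phi> \<in> H1 \<Omega>"
proof -
  let ?g = "\<lambda>x. \<Sum>b\<in>Basis. partial_deriv b \<phi> x *\<^sub>R b"
  obtain K where K: "compact K" "K \<subseteq> \<Omega>" "\<And>x. x \<notin> K \<Longrightarrow> \<phi> x = 0"
    "\<And>x b. x \<notin> K \<Longrightarrow> partial_deriv b \<phi> x = 0"
    by (rule test_function_support[OF \<phi>]) (rule that)
  have "continuous_on UNIV ?g"
    by (intro continuous_on_sum continuous_on_scaleR test_functionD(3)[OF \<phi>] continuous_on_const)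
  then have "?g \<in> L2 \<Omega>"
    using K(1) by (rule L2_compact_support[OF \<Omega>]) (simp add: K(4))
  moreover have "has_weak_gradient \<Omega> \<phi> ?g"
    unfolding has_weak_gradient_def
  proof (intro ballI)
    fix \<psi> and b :: 'a assume "\<psi> \<in> test_functions \<Omega>" and b: "b \<in> Basis"
    from test_function_integration_by_parts[OF \<Omega> \<phi> this]
    show "(LINT x|lebesgue_on \<Omega>. \<phi> x * partial_deriv b \<psi> x) = - (LINT x|lebesgue_on \<Omega>. (?g x \<bullet> b) * \<psi> x)"
      using b by simp
  qed
  ultimately show ?thesis using test_function_L2[OF assms] by (auto simp: H1_def)
qed

section \<open>Uniqueness of weak gradients\<close>

lemma L2_integrable:
  fixes u :: "'a::euclidean_space \<Rightarrow> real"
  assumes "\<Omega> \<in> lmeasurable" "u \<in> L2 \<Omega>"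
  shows "integrable (lebesgue_on \<Omega>) u"
proof -
  interpret finite_measure "lebesgue_on \<Omega>" using assms(1) by (rule finite_measure_lebesgue_on)
  have "(\<lambda>x. 1::real) \<in> L2 \<Omega>" by (simp add: L2_def)
  from L2_integrable_inner[OF assms(2) this] show ?thesis by simp
qed

lemma sigma_finite_lebesgue: "sigma_finite_measure (lebesgue :: 'a::euclidean_space measure)"
proof
  obtain A :: "'a set set" where A: "countable A" "A \<subseteq> sets lborel" "\<Union>A = space lborel"
    "\<forall>a\<in>A. emeasure lborel a \<noteq> \<infinity>"
    using lborel.sigma_finite_countable by blast
  then have "A \<subseteq> sets lebesgue" "\<forall>a\<in>A. emeasure lebesgue a \<noteq> \<infinity>"
    by (auto simp: subset_iff sets_completionI_sets)
  then show "\<exists>A. countable A \<and> A \<subseteq> sets lebesgue \<and> \<Union>A = space lebesgue \<and>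
      (\<forall>a\<in>A. emeasure (lebesgue :: 'a measure) a \<noteq> \<infinity>)"
    using A(1,3) by auto
qed

text \<open>Boxes are stable under intersection and generate the Borel sets, and the sets over which
  K integrates to zero form a Dynkin system. The assumption \<open>total\<close> supplies the step
  to complements, the whole space not being a box.\<close>

lemma AE_eq_0_if_box_integrals_eq_0:
  fixes K :: "'a::euclidean_space \<Rightarrow> real"
  assumes K: "integrable lebesgue K" and total: "(LINT x|lebesgue. K x) = 0"
    and box: "\<And>c d. (LINT x:box c d|lebesgue. K x) = 0"
  shows "AE x in lebesgue. K x = 0"
proof (rule sigma_finite_measure.density_zero[OF _ K])
  show "sigma_finite_measure (lebesgue :: 'a measure)"
    by (rule sigma_finite_lebesgue)
  let ?G = "range (\<lambda>(a, b). box a b :: 'a set)"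
  have si: "set_integrable lebesgue A K" if "A \<in> sets lebesgue" for A
    using K that unfolding set_integrable_def by (intro integrable_mult_indicator)
  have sets_eq: "sigma_sets UNIV ?G = sets borel"
    by (simp add: borel_eq_box)
  have borel: "(LINT x:A|lebesgue. K x) = 0" if "A \<in> sigma_sets UNIV ?G" for A
  proof -
    have "Int_stable ?G" "?G \<subseteq> Pow UNIV"
      by (auto simp: Int_stable_def box_Int_box)
    then show ?thesis using that
    proof (induct rule: sigma_sets_induct_disjoint)
      case (basic B)
      then show ?case using box by auto
    next
      case empty
      show ?case by (simp add: set_lebesgue_integral_def)
    next
      case (compl B)
      have B: "B \<in> sets lebesgue" using compl(1) unfolding sets_eq by simp
      have "UNIV - B \<in> sets lebesgue" using B by auto
      moreover have "(UNIV - B) \<union> B = UNIV" "(UNIV - B) \<inter> B = {}" by auto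
      ultimately have "(LINT x:UNIV|lebesgue. K x) = (LINT x:UNIV - B|lebesgue. K x) + (LINT x:B|lebesgue. K x)"
        using set_integral_Un[OF _ si si] B by metis
      then show ?case using total compl(2) by (simp add: set_lebesgue_integral_def)
    next
      case (union B)
      have B: "B i \<in> sets lebesgue" for i using union(2) unfolding sets_eq by auto
      have "(LINT x:(\<Union>i. B i)|lebesgue. K x) = (\<Sum>i. (LINT x:(B i)|lebesgue. K x))"
        using union(1) B by (intro lebesgue_integral_countable_add si) (auto simp: disjoint_family_on_def)
      then show ?case using union(3) by simp
    qed
  qed
  show "(LINT x:A|lebesgue. K x) = 0" if "A \<in> sets lebesgue" for A
  proof -
    \<comment> \<open>A Lebesgue set is a Borel set up to a part of a Borel null set, so the
      integral over A is the one over S.\<close>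
    from that obtain S N N' where A: "A = S \<union> N" "N \<subseteq> N'" "N' \<in> null_sets lborel" "S \<in> sets lborel"
      by (rule sets_completionE)
    have "AE x in lebesgue. x \<notin> N'"
      using A(3) by (intro AE_not_in null_sets_completionI)
    then have ae: "AE x in lebesgue. x \<in> A \<longleftrightarrow> x \<in> S"
      by eventually_elim (use A in auto)
    have "(LINT x:A|lebesgue. K x) = (LINT x:S|lebesgue. K x)"
      unfolding set_lebesgue_integral_def
    proof (intro integral_cong_AE)
      show "(\<lambda>x. indicator A x *\<^sub>R K x) \<in> borel_measurable lebesgue"
        "(\<lambda>x. indicator S x *\<^sub>R K x) \<in> borel_measurable lebesgue"
        using si[OF that] si[of S] A(4) unfolding set_integrable_def by auto
      show "AE x in lebesgue. indicator A x *\<^sub>R K x = indicator S x *\<^sub>R K x"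
        using ae by eventually_elim (simp add: indicator_def)
    qed
    also have "\<dots> = 0" using A(4) by (intro borel) (simp add: sets_eq)
    finally show ?thesis .
  qed
qed

text \<open>Bumps increase to the indicator of their box, so the function has integral zero over every
  box whose closure lies in the domain.\<close>

theorem fundamental_lemma_calculus_of_variations:
  fixes k :: "'a::euclidean_space \<Rightarrow> real"
  assumes \<Omega>: "open \<Omega>" "bounded \<Omega>" and k: "k \<in> L2 \<Omega>"
    and zero: "\<And>\<phi>. \<phi> \<in> test_functions \<Omega> \<Longrightarrow> (LINT x|lebesgue_on \<Omega>. k x * \<phi> x) = 0"
  shows "AE x in lebesgue_on \<Omega>. k x = 0"
proof -
  have lm: "\<Omega> \<in> lmeasurable" using \<Omega> by (intro lmeasurable_open)
  then have sl: "\<Omega> \<in> sets lebesgue" and sl': "\<Omega> \<inter> space lebesgue \<in> sets lebesgue" by auto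
  have k_int: "integrable (lebesgue_on \<Omega>) k" by (rule L2_integrable[OF lm k])
  have box: "(LINT x:box a b|lebesgue. k x) = 0" and box_int: "set_integrable lebesgue (box a b) k"
    if ab: "cbox a b \<subseteq> \<Omega>" for a b
  proof -
    have sub: "box a b \<subseteq> \<Omega>" using ab box_subset_cbox by blast
    have eq: "indicator \<Omega> x *\<^sub>R (k x * indicator (box a b) x) = indicator (box a b) x *\<^sub>R k x" for x
      using sub by (auto simp: indicator_def)
    have ind: "(indicator (box a b) :: 'a \<Rightarrow> real) \<in> borel_measurable (lebesgue_on \<Omega>)"
      by (intro measurable_restrict_space1 borel_measurable_indicator) auto
    have "(\<lambda>n. LINT x|lebesgue_on \<Omega>. k x * box_bump a b n x)
        \<longlonglongrightarrow> (LINT x|lebesgue_on \<Omega>. k x * indicator (box a b) x)"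
    proof (rule integral_dominated_convergence)
      show "integrable (lebesgue_on \<Omega>) (\<lambda>x. \<bar>k x\<bar>)" using k_int by simp
      show "(\<lambda>x. k x * indicator (box a b) x) \<in> borel_measurable (lebesgue_on \<Omega>)"
        using L2_measurable[OF k] ind by (intro borel_measurable_times)
      show "(\<lambda>x. k x * box_bump a b n x) \<in> borel_measurable (lebesgue_on \<Omega>)" for n
        using L2_measurable[OF k] L2_measurable[OF test_function_L2(1)[OF sl box_bump_test_function[OF ab]]]
        by (intro borel_measurable_times)
      show "AE x in lebesgue_on \<Omega>. (\<lambda>n. k x * box_bump a b n x) \<longlonglongrightarrow> k x * indicator (box a b) x"
        by (intro AE_I2 tendsto_mult tendsto_const box_bump_tendsto_indicator)
      show "AE x in lebesgue_on \<Omega>. norm (k x * box_bump a b n x) \<le> \<bar>k x\<bar>" for n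
        using box_bump_bounds[of a b n] by (intro AE_I2) (simp add: abs_mult abs_of_nonneg mult_left_le)
    qed
    then have "(LINT x|lebesgue_on \<Omega>. k x * indicator (box a b) x) = 0"
      using zero[OF box_bump_test_function[OF ab]] by (simp add: LIMSEQ_const_iff)
    then show "(LINT x:box a b|lebesgue. k x) = 0"
      unfolding set_lebesgue_integral_def integral_restrict_space[OF sl'] eq .
    have "integrable (lebesgue_on \<Omega>) (\<lambda>x. k x * indicator (box a b) x)"
    proof (rule Bochner_Integration.integrable_bound[OF k_int])
      show "(\<lambda>x. k x * indicator (box a b) x) \<in> borel_measurable (lebesgue_on \<Omega>)"
        using L2_measurable[OF k] ind by (intro borel_measurable_times)
    qed (simp add: indicator_def)
    then show "set_integrable lebesgue (box a b) k"
      unfolding set_integrable_def integrable_restrict_space[OF sl'] eq .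
  qed
  \<comment> \<open>k is cut off to one box, which makes it a function on the whole space with known
    integrals over all boxes.\<close>
  have on_cbox: "AE x in lebesgue. x \<in> cbox a b \<longrightarrow> k x = 0" if ab: "cbox a b \<subseteq> \<Omega>" for a b
  proof -
    let ?K = "\<lambda>x. indicator (box a b) x *\<^sub>R k x"
    have "AE x in lebesgue. ?K x = 0"
    proof (rule AE_eq_0_if_box_integrals_eq_0)
      show "integrable lebesgue ?K" using box_int[OF ab] unfolding set_integrable_def .
      show "(LINT x|lebesgue. ?K x) = 0" using box[OF ab] unfolding set_lebesgue_integral_def .
      fix c d
      \<comment> \<open>The same corners describe the open and the closed intersection, so the
        closure of the new box again lies in \<Omega>.\<close>
      obtain e f where ef: "box a b \<inter> box c d = box e f" "cbox a b \<inter> cbox c d = cbox e f"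
        using box_Int_box[of a b c d] Int_interval[of a b c d] by blast
      have "(LINT x:box c d|lebesgue. ?K x) = (LINT x:box e f|lebesgue. k x)"
        unfolding set_lebesgue_integral_def ef(1)[symmetric] by (simp add: indicator_inter_arith mult.assoc mult.left_commute)
      also have "\<dots> = 0" using ef(2) ab by (intro box) blast
      finally show "(LINT x:box c d|lebesgue. ?K x) = 0" .
    qed
    moreover have "AE x in lebesgue. x \<notin> cbox a b - box a b"
      using negligible_frontier_interval[of a b] by (intro AE_not_in) (simp add: negligible_iff_null_sets)
    ultimately show ?thesis by eventually_elim auto
  qed
  \<comment> \<open>The local statements are glued over a countable cover, so the exceptional null
    sets have a null union.\<close>
  obtain \<D> where \<D>: "countable \<D>" "\<D> \<subseteq> Pow \<Omega>" "\<And>X. X \<in> \<D> \<Longrightarrow> \<exists>a b. X = cbox a b" "\<Union>\<D> = \<Omega>"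
    using open_countable_Union_open_cbox[OF \<Omega>(1)] by blast
  have "AE x in lebesgue. \<forall>X\<in>\<D>. x \<in> X \<longrightarrow> k x = 0"
    unfolding AE_ball_countable[OF \<D>(1)]
  proof
    fix X assume X: "X \<in> \<D>"
    then obtain a b where "X = cbox a b" using \<D>(3) by blast
    then show "AE x in lebesgue. x \<in> X \<longrightarrow> k x = 0" using X \<D>(2) on_cbox by blast
  qed
  then have "AE x in lebesgue. x \<in> \<Omega> \<longrightarrow> k x = 0"
    by eventually_elim (use \<D>(4) in blast)
  then show ?thesis using sl by (simp add: AE_restrict_space_iff)
qed

text \<open>Componentwise, g - h is orthogonal to all test functions. This lets the chosen
  \<open>wgrad\<close> be identified almost everywhere with any weak gradient at hand.\<close>

lemma weak_gradient_unique:
  fixes u :: "'a::euclidean_space \<Rightarrow> real"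
  assumes \<Omega>: "open \<Omega>" "bounded \<Omega>" and g: "g \<in> L2 \<Omega>" "has_weak_gradient \<Omega> u g"
    and h: "h \<in> L2 \<Omega>" "has_weak_gradient \<Omega> u h"
  shows "AE x in lebesgue_on \<Omega>. g x = h x"
proof -
  have sl: "\<Omega> \<in> sets lebesgue" using \<Omega>(1) by (simp add: sets_completionI_sets)
  have comp: "(\<lambda>x. p x \<bullet> b) \<in> L2 \<Omega>" if "p \<in> L2 \<Omega>" "b \<in> Basis" for p :: "'a \<Rightarrow> 'a" and b
  proof (rule L2_bound[OF _ that(1)])
    show "(\<lambda>x. p x \<bullet> b) \<in> borel_measurable (lebesgue_on \<Omega>)"
      by (intro borel_measurable_inner L2_measurable that borel_measurable_const)
  qed (use Basis_le_norm[OF that(2)] in simp)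
  have "AE x in lebesgue_on \<Omega>. g x \<bullet> b - h x \<bullet> b = 0" if b: "b \<in> Basis" for b
  proof (rule fundamental_lemma_calculus_of_variations[OF \<Omega> L2_diff[OF comp[OF g(1) b] comp[OF h(1) b]]])
    fix \<phi> assume \<phi>: "\<phi> \<in> test_functions \<Omega>"
    note \<phi>2 = test_function_L2(1)[OF sl \<phi>]
    have "(LINT x|lebesgue_on \<Omega>. (g x \<bullet> b) * \<phi> x) = (LINT x|lebesgue_on \<Omega>. (h x \<bullet> b) * \<phi> x)"
      using g(2)[unfolded has_weak_gradient_def, rule_format, OF \<phi> b]
        h(2)[unfolded has_weak_gradient_def, rule_format, OF \<phi> b] by simp
    then show "(LINT x|lebesgue_on \<Omega>. (g x \<bullet> b - h x \<bullet> b) * \<phi> x) = 0"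
      using L2_integrable_inner[OF comp[OF g(1) b] \<phi>2] L2_integrable_inner[OF comp[OF h(1) b] \<phi>2]
      by (simp add: left_diff_distrib)
  qed
  then have "AE x in lebesgue_on \<Omega>. \<forall>b\<in>Basis. g x \<bullet> b - h x \<bullet> b = 0"
    by (simp add: AE_ball_countable countable_finite)
  then show ?thesis by eventually_elim (rule euclidean_eqI, simp)
qed

section \<open>The spaces \<open>H\<^sup>1(\<Omega>)\<close> and \<open>H\<^sup>1\<^sub>0(\<Omega>)\<close>\<close>

lemma L2_norm_mono:
  assumes "u \<in> L2 \<Omega>" "v \<in> L2 \<Omega>" "0 \<le> c"
    and "AE x in lebesgue_on \<Omega>. norm (u x) \<le> c * norm (v x)"
  shows "L2_norm \<Omega> u \<le> c * L2_norm \<Omega> v"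
proof (rule power2_le_imp_le)
  have "(LINT x|lebesgue_on \<Omega>. (norm (u x))\<^sup>2) \<le> (LINT x|lebesgue_on \<Omega>. c\<^sup>2 * (norm (v x))\<^sup>2)"
  proof (rule integral_mono_AE)
    show "AE x in lebesgue_on \<Omega>. (norm (u x))\<^sup>2 \<le> c\<^sup>2 * (norm (v x))\<^sup>2"
      using assms(4) by eventually_elim (simp add: power_mono flip: power_mult_distrib)
  qed (use assms(1,2) in \<open>simp_all add: L2_def\<close>)
  then show "(L2_norm \<Omega> u)\<^sup>2 \<le> (c * L2_norm \<Omega> v)\<^sup>2"
    by (simp add: L2_norm_def power_mult_distrib)
qed (use assms(3) in \<open>simp add: L2_norm_nonneg\<close>)

text \<open>The pair of a function and its scaled weak gradient embeds \<open>H\<^sup>1(\<Omega>)\<close> into an \<open>L\<^sup>2\<close> space,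
  turning \<open>B\<^sub>\<lambda>\<close> into the inner product and the energy norm into the norm of that space.\<close>

definition jet :: "'a::euclidean_space set \<Rightarrow> real \<Rightarrow> ('a \<Rightarrow> real) \<Rightarrow> 'a \<Rightarrow> real \<times> 'a" where
  "jet \<Omega> lam u x = (u x, sqrt lam *\<^sub>R wgrad \<Omega> u x)"

definition jet_space :: "'a::euclidean_space set \<Rightarrow> real \<Rightarrow> ('a \<Rightarrow> real) set \<Rightarrow> ('a \<Rightarrow> real \<times> 'a) set" where
  "jet_space \<Omega> lam W = {p \<in> L2 \<Omega>. \<exists>w\<in>W. AE x in lebesgue_on \<Omega>. p x = jet \<Omega> lam w x}"

lemma B_form_eq_inner_jet:
  "0 \<le> lam \<Longrightarrow> B_form \<Omega> lam u v = L2_inner \<Omega> (jet \<Omega> lam u) (jet \<Omega> lam v)"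
  by (simp add: B_form_def L2_inner_def jet_def add.commute flip: mult.assoc)

lemma H1_L2: "u \<in> H1 \<Omega> \<Longrightarrow> u \<in> L2 \<Omega>"
  by (simp add: H1_def)

lemma H1_wgrad:
  assumes "u \<in> H1 \<Omega>"
  shows "wgrad \<Omega> u \<in> L2 \<Omega>" "has_weak_gradient \<Omega> u (wgrad \<Omega> u)"
proof -
  have "\<exists>g. g \<in> L2 \<Omega> \<and> has_weak_gradient \<Omega> u g"
    using assms by (auto simp: H1_def)
  from someI_ex[OF this] show "wgrad \<Omega> u \<in> L2 \<Omega>" "has_weak_gradient \<Omega> u (wgrad \<Omega> u)"
    by (simp_all add: wgrad_def)
qed

lemma jet_L2:
  assumes "u \<in> H1 \<Omega>"
  shows "jet \<Omega> lam u \<in> L2 \<Omega>"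
proof -
  have eq: "(norm (jet \<Omega> lam u x))\<^sup>2 = (norm (u x))\<^sup>2 + (norm (sqrt lam *\<^sub>R wgrad \<Omega> u x))\<^sup>2" for x
    by (simp add: jet_def norm_Pair)
  have "jet \<Omega> lam u \<in> borel_measurable (lebesgue_on \<Omega>)"
    unfolding jet_def[abs_def]
    by (intro borel_measurable_Pair L2_measurable H1_L2 assms L2_scale H1_wgrad)
  then show ?thesis
    using L2_integrable_norm_sq[OF H1_L2[OF assms]]
      L2_integrable_norm_sq[OF L2_scale[OF H1_wgrad(1)[OF assms], of "sqrt lam"]]
    unfolding L2_def mem_Collect_eq eq by (intro conjI Bochner_Integration.integrable_add)
qed

lemma L2_norm_jet:
  assumes "u \<in> H1 \<Omega>" "0 \<le> lam"
  shows "L2_norm \<Omega> (jet \<Omega> lam u) = energy_norm \<Omega> lam u"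
proof -
  have eq: "(norm (jet \<Omega> lam u x))\<^sup>2 = (norm (u x))\<^sup>2 + lam * (norm (wgrad \<Omega> u x))\<^sup>2" for x
    using assms(2) by (simp add: jet_def norm_Pair power_mult_distrib)
  show ?thesis
    using L2_integrable_norm_sq[OF H1_L2[OF assms(1)]] L2_integrable_norm_sq[OF H1_wgrad(1)[OF assms(1)]]
    by (simp add: energy_norm_def L2_norm_def eq add.commute)
qed

lemma L2_le_energy_norm: "0 \<le> lam \<Longrightarrow> L2_norm \<Omega> u \<le> energy_norm \<Omega> lam u"
  by (simp add: energy_norm_def real_le_rsqrt)

lemma has_weak_gradient_add_scale:
  assumes sl: "\<Omega> \<in> sets lebesgue"
    and u: "u \<in> L2 \<Omega>" "g \<in> L2 \<Omega>" "has_weak_gradient \<Omega> u g"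
    and v: "v \<in> L2 \<Omega>" "h \<in> L2 \<Omega>" "has_weak_gradient \<Omega> v h"
  shows "has_weak_gradient \<Omega> (\<lambda>x. u x + c * v x) (\<lambda>x. g x + c *\<^sub>R h x)"
  unfolding has_weak_gradient_def
proof (intro ballI)
  fix \<phi> and b :: 'a assume \<phi>: "\<phi> \<in> test_functions \<Omega>" and b: "b \<in> Basis"
  note \<phi>2 = test_function_L2(1)[OF sl \<phi>] and \<phi>3 = test_function_L2(2)[OF sl \<phi> b]
  \<comment> \<open>The product is the inner product of p with the square integrable field \<phi>
    b.\<close>
  have int: "integrable (lebesgue_on \<Omega>) (\<lambda>x. (p x \<bullet> b) * \<phi> x)" if "p \<in> L2 \<Omega>" for p :: "'a \<Rightarrow> 'a"
  proof -
    have "(\<lambda>x. \<phi> x *\<^sub>R b) \<in> L2 \<Omega>"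
    proof (rule L2_bound[OF _ \<phi>2])
      show "(\<lambda>x. \<phi> x *\<^sub>R b) \<in> borel_measurable (lebesgue_on \<Omega>)"
        by (intro borel_measurable_scaleR L2_measurable \<phi>2 borel_measurable_const)
    qed (simp add: b)
    from L2_integrable_inner[OF that this] show ?thesis by (simp add: mult.commute)
  qed
  have "(LINT x|lebesgue_on \<Omega>. (u x + c * v x) * partial_deriv b \<phi> x)
      = (LINT x|lebesgue_on \<Omega>. u x * partial_deriv b \<phi> x) + c * (LINT x|lebesgue_on \<Omega>. v x * partial_deriv b \<phi> x)"
    using L2_integrable_inner[OF u(1) \<phi>3] L2_integrable_inner[OF v(1) \<phi>3]
    by (simp add: distrib_right mult.assoc)
  also have "\<dots> = - ((LINT x|lebesgue_on \<Omega>. (g x \<bullet> b) * \<phi> x) + c * (LINT x|lebesgue_on \<Omega>. (h x \<bullet> b) * \<phi> x))"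
    using u(3)[unfolded has_weak_gradient_def, rule_format, OF \<phi> b]
      v(3)[unfolded has_weak_gradient_def, rule_format, OF \<phi> b] by simp
  also have "\<dots> = - (LINT x|lebesgue_on \<Omega>. ((g x + c *\<^sub>R h x) \<bullet> b) * \<phi> x)"
    using int[OF u(2)] int[OF v(2)] by (simp add: inner_add_left distrib_right mult.assoc)
  finally show "(LINT x|lebesgue_on \<Omega>. (u x + c * v x) * partial_deriv b \<phi> x)
      = - (LINT x|lebesgue_on \<Omega>. ((g x + c *\<^sub>R h x) \<bullet> b) * \<phi> x)" .
qed

section \<open>Linearity and limits of weak gradients; closedness of H^1_0\<close>

locale bounded_open_set =
  fixes \<Omega> :: "'a::euclidean_space set"
  assumes open_domain: "open \<Omega>" and bounded_domain: "bounded \<Omega>"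
begin

lemma sets_lebesgue_domain: "\<Omega> \<in> sets lebesgue"
  using open_domain by (simp add: sets_completionI_sets)

lemma weak_gradient_H1:
  assumes "u \<in> L2 \<Omega>" "g \<in> L2 \<Omega>" "has_weak_gradient \<Omega> u g"
  shows "u \<in> H1 \<Omega>" "AE x in lebesgue_on \<Omega>. wgrad \<Omega> u x = g x"
proof -
  show H: "u \<in> H1 \<Omega>" using assms by (auto simp: H1_def)
  show "AE x in lebesgue_on \<Omega>. wgrad \<Omega> u x = g x"
    by (rule weak_gradient_unique[OF open_domain bounded_domain H1_wgrad[OF H] assms(2,3)])
qed

lemma H1_add_scale:
  assumes u: "u \<in> H1 \<Omega>" and v: "v \<in> H1 \<Omega>"
  shows "(\<lambda>x. u x + c * v x) \<in> H1 \<Omega>"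
    and "AE x in lebesgue_on \<Omega>. wgrad \<Omega> (\<lambda>x. u x + c * v x) x = wgrad \<Omega> u x + c *\<^sub>R wgrad \<Omega> v x"
proof -
  note wg = has_weak_gradient_add_scale[OF sets_lebesgue_domain H1_L2[OF u] H1_wgrad[OF u] H1_L2[OF v] H1_wgrad[OF v], of c]
  have L: "(\<lambda>x. u x + c * v x) \<in> L2 \<Omega>"
    using L2_add[OF H1_L2[OF u] L2_scale[OF H1_L2[OF v], of c]] by simp
  have G: "(\<lambda>x. wgrad \<Omega> u x + c *\<^sub>R wgrad \<Omega> v x) \<in> L2 \<Omega>"
    by (intro L2_add L2_scale H1_wgrad u v)
  show "(\<lambda>x. u x + c * v x) \<in> H1 \<Omega>"
    and "AE x in lebesgue_on \<Omega>. wgrad \<Omega> (\<lambda>x. u x + c * v x) x = wgrad \<Omega> u x + c *\<^sub>R wgrad \<Omega> v x"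
    using weak_gradient_H1[OF L G wg] by blast+
qed

lemma H1_diff: "u \<in> H1 \<Omega> \<Longrightarrow> v \<in> H1 \<Omega> \<Longrightarrow> (\<lambda>x. u x - v x) \<in> H1 \<Omega>"
  using H1_add_scale(1)[of u v "-1"] by simp

lemma jet_add_scale:
  assumes "u \<in> H1 \<Omega>" "v \<in> H1 \<Omega>"
  shows "AE x in lebesgue_on \<Omega>. jet \<Omega> lam (\<lambda>x. u x + c * v x) x = jet \<Omega> lam u x + c *\<^sub>R jet \<Omega> lam v x"
  using H1_add_scale(2)[OF assms, of c] by eventually_elim (simp add: jet_def scaleR_add_right)

lemma jet_diff:
  assumes "u \<in> H1 \<Omega>" "v \<in> H1 \<Omega>"
  shows "AE x in lebesgue_on \<Omega>. jet \<Omega> lam (\<lambda>x. u x - v x) x = jet \<Omega> lam u x - jet \<Omega> lam v x"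
  using jet_add_scale[OF assms, of lam "-1"] by simp

lemma energy_norm_diff:
  assumes "u \<in> H1 \<Omega>" "v \<in> H1 \<Omega>" "0 \<le> lam"
  shows "energy_norm \<Omega> lam (\<lambda>x. u x - v x) = L2_norm \<Omega> (\<lambda>x. jet \<Omega> lam u x - jet \<Omega> lam v x)"
proof -
  have "energy_norm \<Omega> lam (\<lambda>x. u x - v x) = L2_norm \<Omega> (jet \<Omega> lam (\<lambda>x. u x - v x))"
    using assms by (simp add: L2_norm_jet H1_diff)
  also have "\<dots> = L2_norm \<Omega> (\<lambda>x. jet \<Omega> lam u x - jet \<Omega> lam v x)"
    by (intro L2_norm_cong_AE L2_diff jet_L2 H1_diff jet_diff assms)
  finally show ?thesis .
qed

lemma energy_norm_triangle:
  assumes "u \<in> H1 \<Omega>" "v \<in> H1 \<Omega>" "w \<in> H1 \<Omega>" "0 \<le> lam"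
  shows "energy_norm \<Omega> lam (\<lambda>x. u x - w x)
    \<le> energy_norm \<Omega> lam (\<lambda>x. u x - v x) + energy_norm \<Omega> lam (\<lambda>x. v x - w x)"
  using assms by (simp add: energy_norm_diff L2_dist_triangle jet_L2)

text \<open>\<open>H10\<close> and \<open>closed_subspace_H10\<close> are defined with weight 1,
  whereas the iteration lives in weight \<open>dt\<close>. The constant comes from mu G + M \<le> (1
  + mu / lam) (lam G + M) for nonnegative G and M.\<close>

lemma energy_converges_change_weight:
  assumes "energy_converges \<Omega> lam w u" "0 < lam" "0 < mu"
  shows "energy_converges \<Omega> mu w u"
  unfolding energy_converges_def
proof (rule Lim_null_comparison)
  let ?C = "sqrt (1 + mu / lam)"
  have "energy_norm \<Omega> mu v \<le> ?C * energy_norm \<Omega> lam v" for v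
  proof -
    have "mu * G + M \<le> (1 + mu / lam) * (lam * G + M)" if "0 \<le> G" "0 \<le> M" for G M
      using that assms(2,3) by (simp add: field_simps)
    then show ?thesis
      unfolding energy_norm_def real_sqrt_mult[symmetric] by (intro real_sqrt_le_mono) simp
  qed
  then show "\<forall>\<^sub>F n in sequentially. norm (energy_norm \<Omega> mu (\<lambda>x. w n x - u x))
      \<le> ?C * energy_norm \<Omega> lam (\<lambda>x. w n x - u x)"
    using assms(3) by (auto simp: energy_norm_def)
  show "(\<lambda>n. ?C * energy_norm \<Omega> lam (\<lambda>x. w n x - u x)) \<longlonglongrightarrow> 0"
    using tendsto_mult_right_zero[OF assms(1)[unfolded energy_converges_def]] .
qed

text \<open>For a fixed test function both sides of the defining identity are L^2 inner products
  with a fixed factor, hence continuous in u and in its gradient.\<close>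

lemma weak_gradient_closed:
  assumes w: "\<And>n. w n \<in> L2 \<Omega>" "\<And>n. g n \<in> L2 \<Omega>" "\<And>n. has_weak_gradient \<Omega> (w n) (g n)"
    and lim: "u \<in> L2 \<Omega>" "h \<in> L2 \<Omega>" "(\<lambda>n. L2_norm \<Omega> (\<lambda>x. w n x - u x)) \<longlonglongrightarrow> 0"
      "(\<lambda>n. L2_norm \<Omega> (\<lambda>x. g n x - h x)) \<longlonglongrightarrow> 0"
  shows "has_weak_gradient \<Omega> u h"
  unfolding has_weak_gradient_def
proof (intro ballI)
  fix \<phi> and b :: 'a assume \<phi>: "\<phi> \<in> test_functions \<Omega>" and b: "b \<in> Basis"
  note \<phi>2 = test_function_L2(1)[OF sets_lebesgue_domain \<phi>]
    and \<phi>3 = test_function_L2(2)[OF sets_lebesgue_domain \<phi> b]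
  have \<phi>b: "(\<lambda>x. \<phi> x *\<^sub>R b) \<in> L2 \<Omega>"
  proof (rule L2_bound[OF _ \<phi>2])
    show "(\<lambda>x. \<phi> x *\<^sub>R b) \<in> borel_measurable (lebesgue_on \<Omega>)"
      by (intro borel_measurable_scaleR L2_measurable \<phi>2 borel_measurable_const)
  qed (simp add: b)
  have eq: "L2_inner \<Omega> p (\<lambda>x. \<phi> x *\<^sub>R b) = (LINT x|lebesgue_on \<Omega>. (p x \<bullet> b) * \<phi> x)" for p :: "'a \<Rightarrow> 'a"
    by (simp add: L2_inner_def mult.commute)
  have "(\<lambda>n. L2_inner \<Omega> (w n) (partial_deriv b \<phi>)) \<longlonglongrightarrow> L2_inner \<Omega> u (partial_deriv b \<phi>)"
    by (rule L2_inner_tendsto[OF w(1) lim(1) \<phi>3 lim(3)])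
  moreover have "(\<lambda>n. - L2_inner \<Omega> (g n) (\<lambda>x. \<phi> x *\<^sub>R b)) \<longlonglongrightarrow> - L2_inner \<Omega> h (\<lambda>x. \<phi> x *\<^sub>R b)"
    by (intro tendsto_minus L2_inner_tendsto[OF w(2) lim(2) \<phi>b lim(4)])
  moreover have "L2_inner \<Omega> (w n) (partial_deriv b \<phi>) = - L2_inner \<Omega> (g n) (\<lambda>x. \<phi> x *\<^sub>R b)" for n
    unfolding eq using w(3)[of n, unfolded has_weak_gradient_def, rule_format, OF \<phi> b]
    by (simp add: L2_inner_def)
  ultimately have "L2_inner \<Omega> u (partial_deriv b \<phi>) = - L2_inner \<Omega> h (\<lambda>x. \<phi> x *\<^sub>R b)"
    using LIMSEQ_unique by force
  then show "(LINT x|lebesgue_on \<Omega>. u x * partial_deriv b \<phi> x) = - (LINT x|lebesgue_on \<Omega>. (h x \<bullet> b) * \<phi> x)"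
    unfolding eq by (simp add: L2_inner_def)
qed

text \<open>Closedness of the set of jets: the first component of the limit is the limit function,
  and the second, divided by the square root of lam, is its weak gradient.\<close>

lemma H1_limit_of_jets:
  assumes w: "\<And>n. w n \<in> H1 \<Omega>" and q: "q \<in> L2 \<Omega>" and lam: "0 < lam"
    and lim: "(\<lambda>n. L2_norm \<Omega> (\<lambda>x. jet \<Omega> lam (w n) x - q x)) \<longlonglongrightarrow> 0"
  shows "(\<lambda>x. fst (q x)) \<in> H1 \<Omega>" "AE x in lebesgue_on \<Omega>. jet \<Omega> lam (\<lambda>x. fst (q x)) x = q x"
    "energy_converges \<Omega> lam w (\<lambda>x. fst (q x))"
proof -
  define u where "u x = fst (q x)" for x
  define h where "h x = (1 / sqrt lam) *\<^sub>R snd (q x)" for x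
  have q_meas: "q \<in> borel_measurable (lebesgue_on \<Omega>)" by (rule L2_measurable[OF q])
  have norms: "norm (fst y) \<le> norm y" "norm (snd y) \<le> norm y" for y :: "real \<times> 'a"
    by (cases y, simp only: fst_conv snd_conv norm_fst_le norm_snd_le)+
  have "(\<lambda>x. fst (q x)) \<in> borel_measurable (lebesgue_on \<Omega>)"
    "(\<lambda>x. snd (q x)) \<in> borel_measurable (lebesgue_on \<Omega>)"
    by (auto intro!: measurable_compose[OF q_meas] borel_measurable_continuous_onI continuous_intros)
  then have u: "u \<in> L2 \<Omega>" and h: "h \<in> L2 \<Omega>"
    unfolding u_def[abs_def] h_def[abs_def]
    by (auto intro!: L2_scale[of "\<lambda>x. snd (q x)"] L2_bound[OF _ q] simp: norms simp del: real_norm_def)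
  have jd: "(\<lambda>x. jet \<Omega> lam (w n) x - q x) \<in> L2 \<Omega>" for n
    by (intro L2_diff jet_L2 w q)
  have le1: "L2_norm \<Omega> (\<lambda>x. w n x - u x) \<le> 1 * L2_norm \<Omega> (\<lambda>x. jet \<Omega> lam (w n) x - q x)" for n
  proof (rule L2_norm_mono[OF L2_diff[OF H1_L2[OF w] u] jd _ AE_I2])
    show "norm (w n x - u x) \<le> 1 * norm (jet \<Omega> lam (w n) x - q x)" for x
      using norms(1)[of "jet \<Omega> lam (w n) x - q x"] by (simp add: jet_def u_def)
  qed simp
  have le2: "L2_norm \<Omega> (\<lambda>x. wgrad \<Omega> (w n) x - h x)
      \<le> (1 / sqrt lam) * L2_norm \<Omega> (\<lambda>x. jet \<Omega> lam (w n) x - q x)" for n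
  proof (rule L2_norm_mono[OF L2_diff[OF H1_wgrad(1)[OF w] h] jd _ AE_I2])
    fix x
    have "wgrad \<Omega> (w n) x - h x = (1 / sqrt lam) *\<^sub>R snd (jet \<Omega> lam (w n) x - q x)"
      using lam by (simp add: jet_def h_def scaleR_diff_right)
    then show "norm (wgrad \<Omega> (w n) x - h x) \<le> (1 / sqrt lam) * norm (jet \<Omega> lam (w n) x - q x)"
      using norms(2)[of "jet \<Omega> lam (w n) x - q x"] lam by (simp add: divide_right_mono)
  qed (use lam in simp)
  have "has_weak_gradient \<Omega> u h"
  proof (rule weak_gradient_closed[OF H1_L2[OF w] H1_wgrad(1)[OF w] H1_wgrad(2)[OF w] u h])
    show "(\<lambda>n. L2_norm \<Omega> (\<lambda>x. w n x - u x)) \<longlonglongrightarrow> 0"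
      by (rule Lim_null_comparison[OF _ tendsto_mult_right_zero[OF lim, where c = 1]])
         (use le1 in \<open>simp add: L2_norm_nonneg\<close>)
    show "(\<lambda>n. L2_norm \<Omega> (\<lambda>x. wgrad \<Omega> (w n) x - h x)) \<longlonglongrightarrow> 0"
      by (rule Lim_null_comparison[OF _ tendsto_mult_right_zero[OF lim, where c = "1 / sqrt lam"]])
         (use le2 in \<open>simp add: L2_norm_nonneg\<close>)
  qed
  note u' = weak_gradient_H1[OF u h this]
  have jet_u: "AE x in lebesgue_on \<Omega>. jet \<Omega> lam u x = q x"
    using u'(2) by eventually_elim (use lam in \<open>simp add: jet_def u_def h_def\<close>)
  have "energy_norm \<Omega> lam (\<lambda>x. w n x - u x) = L2_norm \<Omega> (\<lambda>x. jet \<Omega> lam (w n) x - q x)" for n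
    unfolding energy_norm_diff[OF w u'(1) less_imp_le[OF lam]]
    by (rule L2_norm_cong_AE[OF L2_diff[OF jet_L2[OF w] jet_L2[OF u'(1)]] jd])
       (use jet_u in eventually_elim, simp)
  then have "energy_converges \<Omega> lam w u"
    using lim by (simp add: energy_converges_def)
  then show "(\<lambda>x. fst (q x)) \<in> H1 \<Omega>" "AE x in lebesgue_on \<Omega>. jet \<Omega> lam (\<lambda>x. fst (q x)) x = q x"
    "energy_converges \<Omega> lam w (\<lambda>x. fst (q x))"
    using u'(1) jet_u by (simp_all add: u_def[abs_def])
qed

lemma H10_H1: "u \<in> H10 \<Omega> \<Longrightarrow> u \<in> H1 \<Omega>"
  by (simp add: H10_def)

text \<open>Diagonal argument: \<open>\<phi> n\<close> is a test function within 1 / (n + 1) of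
  \<open>w n\<close>.\<close>

lemma H10_closed:
  assumes w: "\<And>n. w n \<in> H10 \<Omega>" and u: "u \<in> H1 \<Omega>" and lim: "energy_converges \<Omega> 1 w u"
  shows "u \<in> H10 \<Omega>"
proof -
  have "\<exists>\<phi>\<in>test_functions \<Omega>. energy_norm \<Omega> 1 (\<lambda>x. \<phi> x - w n x) < inverse (real (Suc n))" for n
  proof -
    obtain \<psi> where \<psi>: "\<And>k. \<psi> k \<in> test_functions \<Omega>" "(\<lambda>k. energy_norm \<Omega> 1 (\<lambda>x. \<psi> k x - w n x)) \<longlonglongrightarrow> 0"
      using w[of n] by (auto simp: H10_def energy_converges_def)
    have "\<forall>\<^sub>F k in sequentially. energy_norm \<Omega> 1 (\<lambda>x. \<psi> k x - w n x) < inverse (real (Suc n))"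
      by (rule order_tendstoD(2)[OF \<psi>(2)]) simp
    then show ?thesis using \<psi>(1) eventually_happens'[OF sequentially_bot] by blast
  qed
  then obtain \<phi> where \<phi>: "\<And>n. \<phi> n \<in> test_functions \<Omega>"
    "\<And>n. energy_norm \<Omega> 1 (\<lambda>x. \<phi> n x - w n x) < inverse (real (Suc n))" by metis
  have "energy_converges \<Omega> 1 \<phi> u"
    unfolding energy_converges_def
  proof (rule Lim_null_comparison)
    show "(\<lambda>n. inverse (real (Suc n)) + energy_norm \<Omega> 1 (\<lambda>x. w n x - u x)) \<longlonglongrightarrow> 0"
      using tendsto_add[OF LIMSEQ_inverse_real_of_nat lim[unfolded energy_converges_def]] by simp
    have "energy_norm \<Omega> 1 (\<lambda>x. \<phi> n x - u x)
        \<le> inverse (real (Suc n)) + energy_norm \<Omega> 1 (\<lambda>x. w n x - u x)" for n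
      using energy_norm_triangle[OF test_functions_subset_H1[OF sets_lebesgue_domain \<phi>(1)] H10_H1[OF w] u, of 1 n n]
        \<phi>(2)[of n] by simp
    then show "\<forall>\<^sub>F n in sequentially. norm (energy_norm \<Omega> 1 (\<lambda>x. \<phi> n x - u x))
        \<le> inverse (real (Suc n)) + energy_norm \<Omega> 1 (\<lambda>x. w n x - u x)"
      by (intro always_eventually allI) (simp add: energy_norm_def)
  qed
  then show ?thesis using u \<phi>(1) by (auto simp: H10_def)
qed

end

section \<open>Closed subspaces of H^1_0: completeness and solvability of the linear problem\<close>

locale closed_subspace = bounded_open_set \<Omega> for \<Omega> :: "'a::euclidean_space set" +
  fixes W :: "('a \<Rightarrow> real) set"
  assumes W: "closed_subspace_H10 \<Omega> W"
begin

lemma W_H10: "w \<in> W \<Longrightarrow> w \<in> H10 \<Omega>"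
  using W by (auto simp: closed_subspace_H10_def)

lemma W_H1: "w \<in> W \<Longrightarrow> w \<in> H1 \<Omega>"
  by (rule H10_H1[OF W_H10])

lemma W_add_scale:
  assumes "u \<in> W" "v \<in> W" shows "(\<lambda>x. u x + c * v x) \<in> W"
proof -
  have "(\<lambda>x. c * v x) \<in> W" using W assms(2) by (simp add: closed_subspace_H10_def)
  with assms(1) show ?thesis using W by (simp add: closed_subspace_H10_def)
qed

lemma W_diff: "u \<in> W \<Longrightarrow> v \<in> W \<Longrightarrow> (\<lambda>x. u x - v x) \<in> W"
  using W_add_scale[of u v "-1"] by simp

text \<open>The closedness clause for W speaks only of limits in \<open>H10\<close> and of weight 1,
  so the limit is first placed in \<open>H10\<close> after a change of weight.\<close>

lemma jet_space_limit:
  assumes w: "\<And>n. w n \<in> W" and q: "q \<in> L2 \<Omega>" and lam: "0 < lam"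
    and lim: "(\<lambda>n. L2_norm \<Omega> (\<lambda>x. jet \<Omega> lam (w n) x - q x)) \<longlonglongrightarrow> 0"
  obtains u where "u \<in> W" "AE x in lebesgue_on \<Omega>. jet \<Omega> lam u x = q x" "energy_converges \<Omega> lam w u"
proof -
  note L = H1_limit_of_jets[OF W_H1[OF w] q lam lim]
  have conv: "energy_converges \<Omega> 1 w (\<lambda>x. fst (q x))"
    by (rule energy_converges_change_weight[OF L(3) lam]) simp
  have "(\<lambda>x. fst (q x)) \<in> H10 \<Omega>"
    by (rule H10_closed[OF W_H10[OF w] L(1) conv])
  then have "(\<lambda>x. fst (q x)) \<in> W"
    using W w conv unfolding closed_subspace_H10_def by blast
  then show ?thesis using L(2,3) that by blast
qed

lemma W_complete:
  assumes w: "\<And>n. w n \<in> W" and lam: "0 < lam"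
    and Cauchy: "\<And>e. e > 0 \<Longrightarrow> \<exists>N. \<forall>m\<ge>N. \<forall>n\<ge>N. energy_norm \<Omega> lam (\<lambda>x. w m x - w n x) < e"
  obtains u where "u \<in> W" "energy_converges \<Omega> lam w u"
proof -
  obtain q where q: "q \<in> L2 \<Omega>" "(\<lambda>n. L2_norm \<Omega> (\<lambda>x. jet \<Omega> lam (w n) x - q x)) \<longlonglongrightarrow> 0"
  proof (rule L2_complete[of "\<lambda>n. jet \<Omega> lam (w n)", OF jet_L2[OF W_H1[OF w]]])
    show "\<exists>N. \<forall>m\<ge>N. \<forall>n\<ge>N. L2_norm \<Omega> (\<lambda>x. jet \<Omega> lam (w m) x - jet \<Omega> lam (w n) x) < e"
      if "e > 0" for e
      using Cauchy[OF that] lam by (simp add: energy_norm_diff[OF W_H1[OF w] W_H1[OF w]])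
  qed
  show ?thesis by (rule jet_space_limit[OF w q(1) lam q(2)]) (rule that)
qed

text \<open>The functional on the right is the inner product of (G, 0) with the jet of v. Hence the
  orthogonal projection of (G, 0) onto \<open>jet_space\<close> is, almost everywhere, the jet of a
  solution.\<close>

lemma B_form_solution:
  assumes lam: "0 < lam" and G: "G \<in> L2 \<Omega>"
  obtains u where "u \<in> W" "\<And>v. v \<in> W \<Longrightarrow> B_form \<Omega> lam u v = (LINT x|lebesgue_on \<Omega>. G x * v x)"
proof -
  let ?S = "jet_space \<Omega> lam W" and ?G = "\<lambda>x. (G x, 0::'a)"
  have GL: "?G \<in> L2 \<Omega>"
  proof (rule L2_bound[OF _ G])
    show "?G \<in> borel_measurable (lebesgue_on \<Omega>)"
      by (intro borel_measurable_Pair L2_measurable G borel_measurable_const)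
  qed (simp add: norm_Pair)
  have jS: "jet \<Omega> lam v \<in> ?S" if "v \<in> W" for v
    using that jet_L2[OF W_H1[OF that]] by (auto simp: jet_space_def)
  have comb: "(\<lambda>x. p x + c *\<^sub>R q x) \<in> ?S" if "p \<in> ?S" "q \<in> ?S" for p q c
  proof -
    obtain u v where uv: "u \<in> W" "v \<in> W" "AE x in lebesgue_on \<Omega>. p x = jet \<Omega> lam u x"
      "AE x in lebesgue_on \<Omega>. q x = jet \<Omega> lam v x" "p \<in> L2 \<Omega>" "q \<in> L2 \<Omega>"
      using \<open>p \<in> ?S\<close> \<open>q \<in> ?S\<close> by (auto simp: jet_space_def)
    have "AE x in lebesgue_on \<Omega>. p x + c *\<^sub>R q x = jet \<Omega> lam (\<lambda>x. u x + c * v x) x"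
      using uv(3,4) jet_add_scale[OF W_H1[OF uv(1)] W_H1[OF uv(2)], of lam c] by eventually_elim simp
    then show ?thesis
      using W_add_scale[OF uv(1,2), of c] uv(5,6)
      unfolding jet_space_def by (intro CollectI conjI bexI L2_add L2_scale)
  qed
  have zero_W: "(\<lambda>x. 0) \<in> W" using W by (simp add: closed_subspace_H10_def)
  \<comment> \<open>The jet of the zero function is known to vanish only almost everywhere;
    subtracting it from itself gives exactly zero.\<close>
  have zero: "(\<lambda>x. 0) \<in> ?S"
    using comb[OF jS[OF zero_W] jS[OF zero_W], of "-1"] by simp
  obtain p where p: "p \<in> ?S" "\<And>q. q \<in> ?S \<Longrightarrow> L2_inner \<Omega> p q = L2_inner \<Omega> ?G q"
  proof (rule L2_orthogonal_projection[OF _ zero _ _ _ GL])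
    show "?S \<subseteq> L2 \<Omega>" by (auto simp: jet_space_def)
    show "(\<lambda>x. p x + q x) \<in> ?S" if "p \<in> ?S" "q \<in> ?S" for p q
      using comb[OF that, of 1] by simp
    show "(\<lambda>x. c *\<^sub>R p x) \<in> ?S" if "p \<in> ?S" for c p
      using comb[OF zero that, of c] by simp
    show "q \<in> ?S" if p: "\<And>n. p n \<in> ?S" and q: "q \<in> L2 \<Omega>"
      and lim: "(\<lambda>n. L2_norm \<Omega> (\<lambda>x. p n x - q x)) \<longlonglongrightarrow> 0" for p q
    proof -
      obtain w where w: "\<And>n. w n \<in> W" "\<And>n. AE x in lebesgue_on \<Omega>. p n x = jet \<Omega> lam (w n) x"
        using p unfolding jet_space_def mem_Collect_eq by metis
      have pL: "p n \<in> L2 \<Omega>" for n using p by (simp add: jet_space_def)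
      have "L2_norm \<Omega> (\<lambda>x. p n x - q x) = L2_norm \<Omega> (\<lambda>x. jet \<Omega> lam (w n) x - q x)" for n
        by (intro L2_norm_cong_AE L2_diff jet_L2 W_H1 w(1) q pL) (use w(2)[of n] in eventually_elim, simp)
      with lim have "(\<lambda>n. L2_norm \<Omega> (\<lambda>x. jet \<Omega> lam (w n) x - q x)) \<longlonglongrightarrow> 0" by simp
      then obtain u where u: "u \<in> W" "AE x in lebesgue_on \<Omega>. jet \<Omega> lam u x = q x"
        by (rule jet_space_limit[OF w(1) q lam]) (rule that)
      have "AE x in lebesgue_on \<Omega>. q x = jet \<Omega> lam u x" using u(2) by eventually_elim simp
      then show ?thesis using q u(1) unfolding jet_space_def by blast
    qed
  qed (rule that)
  obtain u where u: "u \<in> W" "AE x in lebesgue_on \<Omega>. p x = jet \<Omega> lam u x" "p \<in> L2 \<Omega>"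
    using p(1) by (auto simp: jet_space_def)
  have "B_form \<Omega> lam u v = (LINT x|lebesgue_on \<Omega>. G x * v x)" if v: "v \<in> W" for v
  proof -
    have jv: "jet \<Omega> lam v \<in> L2 \<Omega>" by (rule jet_L2[OF W_H1[OF v]])
    have "B_form \<Omega> lam u v = L2_inner \<Omega> (jet \<Omega> lam u) (jet \<Omega> lam v)"
      using lam by (simp add: B_form_eq_inner_jet)
    also have "\<dots> = L2_inner \<Omega> p (jet \<Omega> lam v)"
    proof (rule L2_inner_cong_AE[OF jet_L2[OF W_H1[OF u(1)]] jv u(3) jv])
      show "AE x in lebesgue_on \<Omega>. jet \<Omega> lam u x = p x" using u(2) by eventually_elim simp
    qed simp
    also have "\<dots> = L2_inner \<Omega> ?G (jet \<Omega> lam v)" by (rule p(2)[OF jS[OF v]])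
    finally show ?thesis by (simp add: L2_inner_def jet_def)
  qed
  then show ?thesis using u(1) that by blast
qed

end

section \<open>The nonlinearity and the energy\<close>

text \<open>Rounding y down to multiples of 1 / (n + 1) leaves countably many values, for which
  measurability is inherited from the sections; continuity in the second variable then allows the
  limit in n.\<close>

lemma Caratheodory_measurable:
  fixes f :: "'x \<Rightarrow> real \<Rightarrow> real"
  assumes f: "\<And>s. (\<lambda>x. f x s) \<in> borel_measurable M" and y: "y \<in> borel_measurable M"
    and cont: "\<And>x. x \<in> space M \<Longrightarrow> continuous_on UNIV (f x)"
  shows "(\<lambda>x. f x (y x)) \<in> borel_measurable M"
proof (rule borel_measurable_LIMSEQ_metric)
  let ?y = "\<lambda>n x. real_of_int \<lfloor>real (Suc n) * y x\<rfloor> / real (Suc n)"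
  show "(\<lambda>x. f x (?y n x)) \<in> borel_measurable M" for n
  proof (rule measurable_compose_countable[where f = "\<lambda>i x. f x (real_of_int i / real (Suc n))"])
    show "(\<lambda>x. \<lfloor>real (Suc n) * y x\<rfloor>) \<in> measurable M (count_space UNIV)"
      using y by measurable
  qed (rule f)
  fix x assume x: "x \<in> space M"
  have "(\<lambda>n. ?y n x) \<longlonglongrightarrow> y x"
  proof (rule LIM_zero_cancel, rule Lim_null_comparison[OF _ LIMSEQ_inverse_real_of_nat], intro always_eventually allI)
    fix n
    have "\<bar>real_of_int \<lfloor>real (Suc n) * y x\<rfloor> - real (Suc n) * y x\<bar> \<le> 1" by linarith
    moreover have "?y n x - y x = (real_of_int \<lfloor>real (Suc n) * y x\<rfloor> - real (Suc n) * y x) / real (Suc n)"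
      by (simp add: diff_divide_distrib del: of_nat_Suc)
    ultimately show "norm (?y n x - y x) \<le> inverse (real (Suc n))"
      by (simp add: abs_divide inverse_eq_divide divide_right_mono del: of_nat_Suc)
  qed
  moreover have "isCont (f x) (y x)"
    using cont[OF x] by (simp add: continuous_on_eq_continuous_at)
  ultimately show "(\<lambda>n. f x (?y n x)) \<longlonglongrightarrow> f x (y x)"
    by (rule isCont_tendsto_compose[rotated])
qed

text \<open>The derivative of s + lam f(x, s) is lam times the quantity whose essential supremum is
  \<open>sigma_f\<close>, so the mean value inequality applies at almost every x.\<close>

lemma Lambda_f_contraction:
  assumes lam: "lam \<in> Lambda_f \<Omega> f \<rho>" and \<rho>: "0 < \<rho>"
    and diff: "\<And>x s. x \<in> \<Omega> \<Longrightarrow> f x differentiable (at s)"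
  obtains K where "0 \<le> K" "K < 1 + lam * \<rho>"
    "AE x in lebesgue_on \<Omega>. \<forall>s t. \<bar>(s + lam * f x s) - (t + lam * f x t)\<bar> \<le> K * \<bar>s - t\<bar>"
proof -
  have lam0: "0 < lam" and sig: "sigma_f \<Omega> f lam < ereal (\<rho> + 1 / lam)"
    using lam by (auto simp: Lambda_f_def)
  \<comment> \<open>\<open>sigma_f\<close> is an extended real; a real number strictly between it
    and the bound is needed. The later maximum with 0 makes the Lipschitz constant nonnegative and
    stays below the bound, which is positive.\<close>
  obtain z where z: "sigma_f \<Omega> f lam < ereal z" "ereal z < ereal (\<rho> + 1 / lam)"
    using ereal_dense2[OF sig] by blast
  define L where "L = max 0 z"
  have L: "0 \<le> L" "L < \<rho> + 1 / lam" "sigma_f \<Omega> f lam \<le> ereal L"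
    using z \<rho> lam0 by (auto simp: L_def add_pos_pos intro: less_imp_le order_trans[OF less_imp_le[OF z(1)]])
  show ?thesis
  proof (rule that[of "lam * L"])
    show "0 \<le> lam * L" using lam0 L by simp
    have "lam * L < lam * (\<rho> + 1 / lam)" using lam0 L by simp
    then show "lam * L < 1 + lam * \<rho>" using lam0 by (simp add: distrib_left)
    have "AE x in lebesgue_on \<Omega>. (SUP s. ereal \<bar>deriv (f x) s + 1 / lam\<bar>) \<le> sigma_f \<Omega> f lam"
      unfolding sigma_f_def by (rule esssup_AE)
    with AE_space show "AE x in lebesgue_on \<Omega>.
        \<forall>s t. \<bar>(s + lam * f x s) - (t + lam * f x t)\<bar> \<le> lam * L * \<bar>s - t\<bar>"
    proof eventually_elim
      case (elim x)
      have D: "((\<lambda>s. s + lam * f x s) has_field_derivative 1 + lam * deriv (f x) s) (at s)" for s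
      proof -
        have "(f x has_field_derivative deriv (f x) s) (at s)"
          using diff[of x s] elim(1) by (simp add: DERIV_deriv_iff_real_differentiable)
        then show ?thesis by (auto intro!: derivative_eq_intros)
      qed
      have "norm (1 + lam * deriv (f x) s) \<le> lam * L" for s
      proof -
        have "ereal \<bar>deriv (f x) s + 1 / lam\<bar> \<le> ereal L"
          using elim(2) L(3) by (meson SUP_upper UNIV_I order_trans)
        then have "lam * \<bar>deriv (f x) s + 1 / lam\<bar> \<le> lam * L" using lam0 by simp
        moreover have "1 + lam * deriv (f x) s = lam * (deriv (f x) s + 1 / lam)"
          using lam0 by (simp add: distrib_left)
        ultimately show ?thesis using lam0 by (simp add: abs_mult)
      qed
      then have "norm ((s + lam * f x s) - (t + lam * f x t)) \<le> lam * L * norm (s - t)" for s t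
        by (intro field_differentiable_bound[of UNIV _ "\<lambda>s. 1 + lam * deriv (f x) s"])
           (use D in auto)
      then show ?case by simp
    qed
  qed
qed

section \<open>The potential: derivative, measurability, quadratic Taylor remainder\<close>

lemma antiderivative_has_derivative:
  fixes g :: "real \<Rightarrow> real"
  assumes "continuous_on UNIV g"
  shows "((\<lambda>z. LBINT s=0..ereal z. g s) has_real_derivative g z) (at z)"
proof -
  \<comment> \<open>The interval contains the base point 0, and its margin 1 puts z into the
    interior, so the derivative within it is the full derivative.\<close>
  let ?a = "min 0 z - 1" and ?b = "max 0 z + 1"
  have "((\<lambda>u. LBINT s=ereal 0..ereal u. g s) has_vector_derivative g z) (at z within {?a..?b})"
    by (rule interval_integral_FTC2) (use assms in \<open>auto intro: continuous_on_subset\<close>)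
  then have "((\<lambda>u. LBINT s=0..ereal u. g s) has_vector_derivative g z) (at z)"
    by (simp add: at_within_Icc_at zero_ereal_def)
  then show ?thesis by (simp add: has_real_derivative_iff_has_vector_derivative)
qed

text \<open>The Caratheodory argument is used twice: on the product space for joint measurability of
  f, which makes the integral up to a fixed z measurable in x, and then for inserting y as the upper
  limit.\<close>

lemma antiderivative_measurable:
  fixes f :: "'x \<Rightarrow> real \<Rightarrow> real"
  assumes f: "\<And>s. (\<lambda>x. f x s) \<in> borel_measurable M" and y: "y \<in> borel_measurable M"
    and cont: "\<And>x. x \<in> space M \<Longrightarrow> continuous_on UNIV (f x)"
  shows "(\<lambda>x. LBINT s=0..ereal (y x). f x s) \<in> borel_measurable M"
proof (rule Caratheodory_measurable[OF _ y])
  have joint: "(\<lambda>p. f (fst p) (snd p)) \<in> borel_measurable (M \<Otimes>\<^sub>M lborel)"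
  proof (rule Caratheodory_measurable[where f = "\<lambda>p. f (fst p)"])
    show "(\<lambda>p. f (fst p) s) \<in> borel_measurable (M \<Otimes>\<^sub>M lborel)" for s
      by (rule measurable_compose[OF measurable_fst f])
    show "continuous_on UNIV (f (fst p))" if "p \<in> space (M \<Otimes>\<^sub>M lborel)" for p
      using that by (intro cont) (auto simp: space_pair_measure)
  qed measurable
  have "(\<lambda>x. LINT s:A|lborel. f x s) \<in> borel_measurable M" if A: "A \<in> sets borel" for A
    unfolding set_lebesgue_integral_def
  proof (rule lborel.borel_measurable_lebesgue_integral)
    have "(\<lambda>p. indicator A (snd p) *\<^sub>R f (fst p) (snd p)) \<in> borel_measurable (M \<Otimes>\<^sub>M lborel)"
      using A by (intro borel_measurable_scaleR joint measurable_compose[OF measurable_snd] borel_measurable_indicator) simp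
    then show "(\<lambda>(x, s). indicator A s *\<^sub>R f x s) \<in> borel_measurable (M \<Otimes>\<^sub>M lborel)"
      by (simp add: case_prod_beta')
  qed
  then show "(\<lambda>x. LBINT s=0..ereal z. f x s) \<in> borel_measurable M" for z
    unfolding interval_lebesgue_integral_def by (cases "0 \<le> ereal z") (simp_all only: if_True if_False borel_measurable_uminus borel_einterval)
  show "continuous_on UNIV (\<lambda>z. LBINT s=0..ereal z. f x s)" if "x \<in> space M" for x
    using antiderivative_has_derivative[OF cont[OF that]]
    by (intro continuous_at_imp_continuous_on ballI) (rule DERIV_isCont)
qed

text \<open>The function k \<mapsto> F(z + k) - g(z) k, with F the antiderivative, has derivative
  g(z + k) - g(z), at most C \<bar>h\<bar> in absolute value for \<bar>k\<bar> \<le> \<bar>h\<bar>.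
  The mean value inequality gives C where integration would give C / 2.\<close>

lemma antiderivative_Taylor_bound:
  fixes g :: "real \<Rightarrow> real"
  assumes cont: "continuous_on UNIV g" and C: "0 \<le> C" "\<And>s t. \<bar>g s - g t\<bar> \<le> C * \<bar>s - t\<bar>"
  shows "\<bar>(LBINT s=0..ereal (z + h). g s) - (LBINT s=0..ereal z. g s) - g z * h\<bar> \<le> C * h\<^sup>2"
proof -
  let ?\<phi> = "\<lambda>k. (LBINT s=0..ereal (z + k). g s) - g z * k"
  let ?S = "{- \<bar>h\<bar>..\<bar>h\<bar>}"
  have "norm (?\<phi> h - ?\<phi> 0) \<le> C * \<bar>h\<bar> * norm (h - 0)"
  proof (rule field_differentiable_bound[of ?S _ "\<lambda>k. g (z + k) - g z"])
    fix k assume k: "k \<in> ?S"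
    have "((\<lambda>k. LBINT s=0..ereal (z + k). g s) has_real_derivative g (z + k) * (0 + 1)) (at k)"
      by (rule DERIV_chain2[OF antiderivative_has_derivative[OF cont]]) (auto intro!: derivative_eq_intros)
    then have "(?\<phi> has_real_derivative g (z + k) - g z) (at k)"
      by (auto intro!: derivative_eq_intros)
    then show "(?\<phi> has_field_derivative g (z + k) - g z) (at k within ?S)"
      by (rule has_field_derivative_at_within)
    have "\<bar>g (z + k) - g z\<bar> \<le> C * \<bar>k\<bar>" using C(2)[of "z + k" z] by simp
    also have "\<dots> \<le> C * \<bar>h\<bar>" using C(1) k by (intro mult_left_mono) auto
    finally show "norm (g (z + k) - g z) \<le> C * \<bar>h\<bar>" by simp
  qed auto
  then show ?thesis by (simp add: power2_eq_square abs_mult_self_eq mult.assoc algebra_simps)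
qed

lemma DERIV_if_quadratic_remainder:
  fixes P :: "real \<Rightarrow> real"
  assumes "\<And>t. \<bar>P t - P 0 - t * D\<bar> \<le> A * t\<^sup>2"
  shows "(P has_real_derivative D) (at 0)"
  unfolding DERIV_def
proof (rule LIM_zero_cancel, rule Lim_null_comparison)
  show "\<forall>\<^sub>F t in at 0. norm ((P (0 + t) - P 0) / t - D) \<le> A * \<bar>t\<bar>"
    unfolding eventually_at_filter
  proof (intro always_eventually allI impI)
    fix t :: real assume "t \<noteq> 0"
    then have "norm ((P (0 + t) - P 0) / t - D) = \<bar>P t - P 0 - t * D\<bar> / \<bar>t\<bar>"
      by (simp add: field_simps flip: abs_divide)
    also have "\<dots> \<le> A * t\<^sup>2 / \<bar>t\<bar>"
      using assms by (intro divide_right_mono) auto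
    also have "\<dots> = A * \<bar>t\<bar>"
      using \<open>t \<noteq> 0\<close> by (simp add: power2_eq_square abs_if)
    finally show "norm ((P (0 + t) - P 0) / t - D) \<le> A * \<bar>t\<bar>" .
  qed
  show "((\<lambda>t. A * \<bar>t\<bar>) \<longlongrightarrow> 0) (at 0)"
    by (auto intro!: tendsto_eq_intros)
qed

section \<open>The superposition operator on L^2 and differentiability of the energy\<close>

locale semilinear_problem = bounded_open_set \<Omega> for \<Omega> :: "'a::euclidean_space set" +
  fixes f :: "'a \<Rightarrow> real \<Rightarrow> real" and dt K :: real
  assumes f_measurable: "\<And>s. (\<lambda>x. f x s) \<in> borel_measurable (lebesgue_on \<Omega>)"
    and f_continuous: "\<And>x. x \<in> \<Omega> \<Longrightarrow> continuous_on UNIV (f x)"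
    and f_0: "(\<lambda>x. f x 0) \<in> L2 \<Omega>"
    and dt_pos: "0 < dt" and K_nonneg: "0 \<le> K"
    and contraction: "AE x in lebesgue_on \<Omega>. \<forall>s t. \<bar>(s + dt * f x s) - (t + dt * f x t)\<bar> \<le> K * \<bar>s - t\<bar>"
begin

text \<open>A Lipschitz constant for f itself: \<open>dt\<close> f is the K-Lipschitz map s +
  \<open>dt\<close> f(x, s) minus the identity.\<close>

definition C_f :: real where "C_f = (K + 1) / dt"

lemma C_f_nonneg: "0 \<le> C_f"
  using K_nonneg dt_pos by (simp add: C_f_def)

lemma f_Lipschitz: "AE x in lebesgue_on \<Omega>. \<forall>s t. \<bar>f x s - f x t\<bar> \<le> C_f * \<bar>s - t\<bar>"
  using contraction
proof eventually_elim
  case (elim x)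
  have "\<bar>f x s - f x t\<bar> \<le> C_f * \<bar>s - t\<bar>" for s t
  proof -
    have "dt * \<bar>f x s - f x t\<bar> = \<bar>dt * (f x s - f x t)\<bar>"
      using dt_pos by (simp add: abs_mult)
    also have "\<dots> \<le> \<bar>(s + dt * f x s) - (t + dt * f x t)\<bar> + \<bar>s - t\<bar>"
      by (simp add: right_diff_distrib)
    also have "\<dots> \<le> (K + 1) * \<bar>s - t\<bar>"
      using elim[rule_format, of s t] by (simp add: distrib_right)
    finally show ?thesis using dt_pos by (simp add: C_f_def pos_le_divide_eq mult.commute)
  qed
  then show ?case by blast
qed

text \<open>The Lipschitz bound gives linear growth around the square integrable function f(x,
  0).\<close>

lemma f_compose_L2:
  assumes y: "y \<in> L2 \<Omega>"
  shows "(\<lambda>x. f x (y x)) \<in> L2 \<Omega>"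
proof (rule L2_bound)
  have abs_L2: "(\<lambda>x. \<bar>w x\<bar>) \<in> L2 \<Omega>" if "w \<in> L2 \<Omega>" for w :: "'a \<Rightarrow> real"
    using that by (auto simp: L2_def)
  show "(\<lambda>x. f x (y x)) \<in> borel_measurable (lebesgue_on \<Omega>)"
    by (rule Caratheodory_measurable[OF f_measurable L2_measurable[OF y]]) (simp add: f_continuous)
  show "(\<lambda>x. \<bar>f x 0\<bar> + C_f *\<^sub>R \<bar>y x\<bar>) \<in> L2 \<Omega>"
    by (intro L2_add L2_scale abs_L2 f_0 y)
  show "AE x in lebesgue_on \<Omega>. norm (f x (y x)) \<le> norm (\<bar>f x 0\<bar> + C_f *\<^sub>R \<bar>y x\<bar>)"
    using f_Lipschitz
  proof eventually_elim
    case (elim x)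
    show ?case using elim[rule_format, of "y x" 0] C_f_nonneg by simp
  qed
qed

lemma step_source_L2:
  assumes "y \<in> L2 \<Omega>"
  shows "(\<lambda>x. y x + dt * f x (y x)) \<in> L2 \<Omega>"
  using L2_add[OF assms L2_scale[OF f_compose_L2[OF assms], of dt]] by simp

lemma step_source_contraction:
  assumes y: "y \<in> L2 \<Omega>" and z: "z \<in> L2 \<Omega>"
  shows "L2_norm \<Omega> (\<lambda>x. (y x + dt * f x (y x)) - (z x + dt * f x (z x))) \<le> K * L2_norm \<Omega> (\<lambda>x. y x - z x)"
proof (rule L2_norm_mono[OF L2_diff[OF step_source_L2 step_source_L2] L2_diff K_nonneg])
  show "AE x in lebesgue_on \<Omega>. norm ((y x + dt * f x (y x)) - (z x + dt * f x (z x))) \<le> K * norm (y x - z x)"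
    using contraction by eventually_elim (unfold real_norm_def, blast)
qed (fact y z)+

lemma f_antiderivative_remainder:
  "AE x in lebesgue_on \<Omega>. \<forall>z h.
    \<bar>(LBINT s=0..ereal (z + h). f x s) - (LBINT s=0..ereal z. f x s) - f x z * h\<bar> \<le> C_f * h\<^sup>2"
  using f_Lipschitz AE_space
proof eventually_elim
  case (elim x)
  then show ?case
    using antiderivative_Taylor_bound[OF f_continuous C_f_nonneg] by simp
qed

lemma f_antiderivative_integrable:
  assumes u: "u \<in> L2 \<Omega>"
  shows "integrable (lebesgue_on \<Omega>) (\<lambda>x. LBINT s=0..ereal (u x). f x s)"
proof (rule Bochner_Integration.integrable_bound)
  show "integrable (lebesgue_on \<Omega>) (\<lambda>x. \<bar>f x 0 * u x\<bar> + C_f * (u x)\<^sup>2)"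
    using L2_integrable_inner[OF f_0 u] L2_integrable_norm_sq[OF u]
    by (intro Bochner_Integration.integrable_add integrable_abs integrable_mult_right) simp_all
  show "(\<lambda>x. LBINT s=0..ereal (u x). f x s) \<in> borel_measurable (lebesgue_on \<Omega>)"
    by (rule antiderivative_measurable[OF f_measurable L2_measurable[OF u]]) (simp add: f_continuous)
  show "AE x in lebesgue_on \<Omega>. norm (LBINT s=0..ereal (u x). f x s) \<le> norm (\<bar>f x 0 * u x\<bar> + C_f * (u x)\<^sup>2)"
    using f_antiderivative_remainder
  proof eventually_elim
    case (elim x)
    \<comment> \<open>The Taylor bound at base point 0, where the potential vanishes.\<close>
    have "\<bar>(LBINT s=0..ereal (u x). f x s) - f x 0 * u x\<bar> \<le> C_f * (u x)\<^sup>2"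
      using elim[rule_format, of 0 "u x"] by (simp flip: zero_ereal_def)
    then show ?case using C_f_nonneg by simp
  qed
qed

text \<open>Integrating the pointwise remainder gives an error of order t^2 directly, without
  interchanging a limit and an integral.\<close>

lemma potential_remainder:
  assumes u: "u \<in> L2 \<Omega>" and v: "v \<in> L2 \<Omega>"
  shows "\<bar>(LINT x|lebesgue_on \<Omega>. LBINT s=0..ereal (u x + t * v x). f x s)
      - (LINT x|lebesgue_on \<Omega>. LBINT s=0..ereal (u x). f x s)
      - t * (LINT x|lebesgue_on \<Omega>. f x (u x) * v x)\<bar> \<le> C_f * (L2_norm \<Omega> v)\<^sup>2 * t\<^sup>2"
proof -
  let ?F = "\<lambda>u x. LBINT s=0..ereal (u x). f x s"
  let ?r = "\<lambda>x. ?F (\<lambda>x. u x + t * v x) x - ?F u x - t * (f x (u x) * v x)"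
  have ut: "(\<lambda>x. u x + t * v x) \<in> L2 \<Omega>" using L2_add[OF u L2_scale[OF v, of t]] by simp
  have int: "integrable (lebesgue_on \<Omega>) (\<lambda>x. f x (u x) * v x)"
    using L2_integrable_inner[OF f_compose_L2[OF u] v] by simp
  note ints = f_antiderivative_integrable[OF ut] f_antiderivative_integrable[OF u] int
  have r_int: "integrable (lebesgue_on \<Omega>) ?r"
    by (intro Bochner_Integration.integrable_diff integrable_mult_right ints)
  have "\<bar>LINT x|lebesgue_on \<Omega>. ?r x\<bar> \<le> (LINT x|lebesgue_on \<Omega>. \<bar>?r x\<bar>)"
    by (rule integral_abs_bound)
  also have "\<dots> \<le> (LINT x|lebesgue_on \<Omega>. C_f * t\<^sup>2 * (norm (v x))\<^sup>2)"
  proof (rule integral_mono_AE)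
    show "integrable (lebesgue_on \<Omega>) (\<lambda>x. C_f * t\<^sup>2 * (norm (v x))\<^sup>2)"
      by (intro integrable_mult_right L2_integrable_norm_sq v)
    show "AE x in lebesgue_on \<Omega>. \<bar>?r x\<bar> \<le> C_f * t\<^sup>2 * (norm (v x))\<^sup>2"
      using f_antiderivative_remainder
    proof eventually_elim
      case (elim x)
      show ?case using elim[rule_format, of "u x" "t * v x"]
        by (simp add: power_mult_distrib mult.assoc mult.left_commute)
    qed
  qed (use r_int in simp)
  also have "\<dots> = C_f * (L2_norm \<Omega> v)\<^sup>2 * t\<^sup>2"
    by (simp add: L2_norm_def)
  finally show ?thesis using ints by simp
qed

theorem energy_has_gateaux_derivative:
  assumes u: "u \<in> H1 \<Omega>"
  shows "has_gateaux_derivative_H10 \<Omega> (energy \<Omega> f) u (energy_deriv \<Omega> f u)"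
  unfolding has_gateaux_derivative_H10_def
proof
  fix v assume "v \<in> H10 \<Omega>"
  then have v: "v \<in> H1 \<Omega>" by (rule H10_H1)
  note gu = H1_wgrad(1)[OF u] and gv = H1_wgrad(1)[OF v]
  let ?a = "L2_inner \<Omega> (wgrad \<Omega> u) (wgrad \<Omega> v)"
  let ?D = "LINT x|lebesgue_on \<Omega>. f x (u x) * v x"
  let ?\<Phi> = "\<lambda>t. LINT x|lebesgue_on \<Omega>. LBINT s=0..ereal (u x + t * v x). f x s"
  have E: "energy \<Omega> f (\<lambda>x. u x + t * v x)
      = 1 / 2 * ((L2_norm \<Omega> (wgrad \<Omega> u))\<^sup>2 + 2 * t * ?a + t\<^sup>2 * (L2_norm \<Omega> (wgrad \<Omega> v))\<^sup>2) - ?\<Phi> t" for t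
  proof -
    have "(LINT x|lebesgue_on \<Omega>. (norm (wgrad \<Omega> (\<lambda>x. u x + t * v x) x))\<^sup>2)
        = (L2_norm \<Omega> (wgrad \<Omega> (\<lambda>x. u x + t * v x)))\<^sup>2"
      by (simp add: L2_norm_def)
    also have "\<dots> = (L2_norm \<Omega> (\<lambda>x. wgrad \<Omega> u x + t *\<^sub>R wgrad \<Omega> v x))\<^sup>2"
      using L2_norm_cong_AE[OF H1_wgrad(1)[OF H1_add_scale(1)[OF u v]] L2_add[OF gu L2_scale[OF gv]] H1_add_scale(2)[OF u v]]
      by simp
    also have "\<dots> = (L2_norm \<Omega> (wgrad \<Omega> u))\<^sup>2 + 2 * t * ?a + t\<^sup>2 * (L2_norm \<Omega> (wgrad \<Omega> v))\<^sup>2"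
      by (subst L2_norm_sq_add[OF gu L2_scale[OF gv]])
         (simp add: L2_norm_scale power_mult_distrib L2_inner_commute[of _ "wgrad \<Omega> u"] L2_inner_scale_left)
    finally show ?thesis by (simp add: energy_def)
  qed
  have deriv_eq: "energy_deriv \<Omega> f u v = ?a - ?D"
    using L2_integrable_inner[OF gu gv] L2_integrable_inner[OF f_compose_L2[OF H1_L2[OF u]] H1_L2[OF v]]
    by (simp add: energy_deriv_def L2_inner_def)
  show "((\<lambda>t. energy \<Omega> f (\<lambda>x. u x + t * v x)) has_real_derivative energy_deriv \<Omega> f u v) (at 0)"
  proof (rule DERIV_if_quadratic_remainder)
    fix t
    let ?N = "(L2_norm \<Omega> (wgrad \<Omega> v))\<^sup>2"
    have "\<bar>?\<Phi> t - ?\<Phi> 0 - t * ?D\<bar> \<le> C_f * (L2_norm \<Omega> v)\<^sup>2 * t\<^sup>2"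
      using potential_remainder[OF H1_L2[OF u] H1_L2[OF v], of t] by simp
    \<comment> \<open>The Dirichlet part is a quadratic polynomial in t, so its remainder is exactly
      its t^2 term.\<close>
    moreover have "energy \<Omega> f (\<lambda>x. u x + t * v x) - energy \<Omega> f (\<lambda>x. u x + 0 * v x) - t * energy_deriv \<Omega> f u v
        = 1 / 2 * ?N * t\<^sup>2 - (?\<Phi> t - ?\<Phi> 0 - t * ?D)"
      unfolding E deriv_eq by (simp add: algebra_simps)
    moreover have "\<bar>1 / 2 * ?N * t\<^sup>2\<bar> = 1 / 2 * ?N * t\<^sup>2" by simp
    ultimately show "\<bar>energy \<Omega> f (\<lambda>x. u x + t * v x) - energy \<Omega> f (\<lambda>x. u x + 0 * v x) - t * energy_deriv \<Omega> f u v\<bar>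
        \<le> (1 / 2 * ?N + C_f * (L2_norm \<Omega> v)\<^sup>2) * t\<^sup>2"
      unfolding distrib_right by linarith
  qed
qed

end

section \<open>The iteration\<close>

locale iteration_problem = semilinear_problem \<Omega> f dt K + closed_subspace \<Omega> W
  for \<Omega> :: "'a::euclidean_space set" and f dt K and W :: "('a \<Rightarrow> real) set" +
  fixes \<rho> :: real
  assumes \<rho>_pos: "0 < \<rho>" and K_less: "K < 1 + dt * \<rho>"
    and coercive: "\<And>v. v \<in> W \<Longrightarrow> \<rho> * (L2_norm \<Omega> v)\<^sup>2 \<le> (L2_norm \<Omega> (wgrad \<Omega> v))\<^sup>2"
begin

text \<open>A relation, because a solution is determined only up to almost everywhere equality and
  every representative in W counts.\<close>

definition step :: "('a \<Rightarrow> real) \<Rightarrow> ('a \<Rightarrow> real) \<Rightarrow> bool" where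
  "step y w \<longleftrightarrow> w \<in> W \<and> (\<forall>v\<in>W. B_form \<Omega> dt w v = l_form \<Omega> f dt y v)"

definition q :: real where "q = K / (1 + dt * \<rho>)"

lemma denominator_pos: "0 < 1 + dt * \<rho>"
  using dt_pos \<rho>_pos by (simp add: add_pos_pos)

lemma q_bounds: "0 \<le> q" "q < 1"
  using denominator_pos K_nonneg K_less by (auto simp: q_def divide_simps)

lemma step_exists:
  assumes "y \<in> L2 \<Omega>"
  shows "\<exists>w. step y w"
proof -
  obtain w where "w \<in> W"
    "\<And>v. v \<in> W \<Longrightarrow> B_form \<Omega> dt w v = (LINT x|lebesgue_on \<Omega>. (y x + dt * f x (y x)) * v x)"
    by (rule B_form_solution[OF dt_pos step_source_L2[OF assms]]) (rule that)
  then show ?thesis by (auto simp: step_def l_form_def)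
qed

lemma W_L2: "w \<in> W \<Longrightarrow> w \<in> L2 \<Omega>"
  by (rule H1_L2[OF W_H1])

lemma l_form_diff:
  assumes "y \<in> L2 \<Omega>" "z \<in> L2 \<Omega>" "v \<in> L2 \<Omega>"
  shows "l_form \<Omega> f dt y v - l_form \<Omega> f dt z v
    = L2_inner \<Omega> (\<lambda>x. (y x + dt * f x (y x)) - (z x + dt * f x (z x))) v"
  using L2_inner_diff_left[OF step_source_L2[OF assms(1)] step_source_L2[OF assms(2)] assms(3)]
  by (simp add: l_form_def L2_inner_def)

lemma step_contraction:
  assumes y: "y \<in> L2 \<Omega>" and z: "z \<in> L2 \<Omega>" and p: "step y p" and r: "step z r"
  shows "energy_norm \<Omega> dt (\<lambda>x. p x - r x) \<le> K * L2_norm \<Omega> (\<lambda>x. y x - z x)"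
    and "L2_norm \<Omega> (\<lambda>x. p x - r x) \<le> q * L2_norm \<Omega> (\<lambda>x. y x - z x)"
proof -
  let ?d = "\<lambda>x. p x - r x"
  let ?m = "L2_norm \<Omega> ?d" and ?E = "energy_norm \<Omega> dt ?d" and ?k = "K * L2_norm \<Omega> (\<lambda>x. y x - z x)"
  have pW: "p \<in> W" and rW: "r \<in> W" using p r by (auto simp: step_def)
  have dW: "?d \<in> W" by (rule W_diff[OF pW rW])
  note dL = W_L2[OF dW]
  note jp = jet_L2[OF W_H1[OF pW], of dt] and jr = jet_L2[OF W_H1[OF rW], of dt]
    and jd = jet_L2[OF W_H1[OF dW], of dt]
  have k0: "0 \<le> ?k" by (intro mult_nonneg_nonneg K_nonneg L2_norm_nonneg)
  have m0: "0 \<le> ?m" by (rule L2_norm_nonneg)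
  have "?E\<^sup>2 = L2_inner \<Omega> (jet \<Omega> dt ?d) (jet \<Omega> dt ?d)"
    using L2_norm_jet[OF W_H1[OF dW], of dt] dt_pos by (simp flip: L2_norm_sq)
  also have "\<dots> = L2_inner \<Omega> (\<lambda>x. jet \<Omega> dt p x - jet \<Omega> dt r x) (jet \<Omega> dt ?d)"
    by (rule L2_inner_cong_AE[OF jd jd L2_diff[OF jp jr] jd jet_diff[OF W_H1[OF pW] W_H1[OF rW]]]) simp
  also have "\<dots> = B_form \<Omega> dt p ?d - B_form \<Omega> dt r ?d"
    using dt_pos by (simp add: L2_inner_diff_left[OF jp jr jd] B_form_eq_inner_jet)
  also have "\<dots> = l_form \<Omega> f dt y ?d - l_form \<Omega> f dt z ?d"
    using p r dW by (simp add: step_def)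
  also have "\<dots> = L2_inner \<Omega> (\<lambda>x. (y x + dt * f x (y x)) - (z x + dt * f x (z x))) ?d"
    by (rule l_form_diff[OF y z dL])
  also have "\<dots> \<le> L2_norm \<Omega> (\<lambda>x. (y x + dt * f x (y x)) - (z x + dt * f x (z x))) * ?m"
    using L2_Cauchy_Schwarz[OF L2_diff[OF step_source_L2[OF y] step_source_L2[OF z]] dL] by (rule abs_le_D1)
  also have "\<dots> \<le> ?k * ?m"
    by (intro mult_right_mono step_source_contraction[OF y z] m0)
  finally have E_le: "?E\<^sup>2 \<le> ?k * ?m" .
  have "?E\<^sup>2 = dt * (L2_norm \<Omega> (wgrad \<Omega> ?d))\<^sup>2 + ?m\<^sup>2"
    using dt_pos by (simp add: energy_norm_def)
  also have "\<dots> \<ge> dt * (\<rho> * ?m\<^sup>2) + ?m\<^sup>2"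
    using coercive[OF dW] dt_pos by simp
  finally have "((1 + dt * \<rho>) * ?m) * ?m \<le> ?k * ?m"
    using E_le by (simp add: algebra_simps power2_eq_square)
  \<comment> \<open>A positive norm is cancelled; for norm zero the claim is nonnegativity of the
    right-hand side.\<close>
  then have "(1 + dt * \<rho>) * ?m \<le> ?k"
    using m0 k0 by (cases "?m = 0") simp_all
  then show "?m \<le> q * L2_norm \<Omega> (\<lambda>x. y x - z x)"
    using denominator_pos by (simp add: q_def pos_le_divide_eq mult.commute)
  have m_le: "?m \<le> ?E" using dt_pos by (intro L2_le_energy_norm) simp
  \<comment> \<open>The L^2 norm of the difference is below its energy norm, so the same estimate
    also yields the energy bound after cancelling one factor.\<close>
  then have "?E * ?E \<le> ?k * ?E"
    using E_le k0 mult_left_mono[OF m_le k0] by (simp add: power2_eq_square)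
  then show "?E \<le> ?k"
    using m0 m_le k0 by (cases "?E = 0") simp_all
qed

lemma generated_sequence_iff: "generated_sequence \<Omega> f W dt y u \<longleftrightarrow> u 0 = y \<and> (\<forall>n. step (u n) (u (Suc n)))"
  by (auto simp: generated_sequence_def step_def)

lemma generated_sequence_exists:
  assumes "y \<in> L2 \<Omega>"
  shows "\<exists>u. generated_sequence \<Omega> f W dt y u"
proof -
  define u where "u = rec_nat y (\<lambda>_ z. SOME w. step z w)"
  have next_step: "step (u n) (u (Suc n))" if "u n \<in> L2 \<Omega>" for n
    using someI_ex[OF step_exists[OF that]] by (simp add: u_def)
  have "u n \<in> L2 \<Omega>" for n
  proof (induction n)
    case 0
    then show ?case using assms by (simp add: u_def)
  next
    case (Suc n)
    then show ?case using next_step[of n] W_L2 by (simp add: step_def)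
  qed
  moreover have "u 0 = y" by (simp add: u_def)
  ultimately show ?thesis using next_step unfolding generated_sequence_iff by blast
qed

lemma generated_sequence_L2:
  assumes "y \<in> L2 \<Omega>" "generated_sequence \<Omega> f W dt y u"
  shows "u n \<in> L2 \<Omega>"
  using assms W_L2 by (cases n) (auto simp: generated_sequence_iff step_def)

text \<open>Comparing two initial values serves three ends: equal ones give uniqueness of the
  iterates, a sequence and its own shift give geometric increments, and a constant sequence at a
  fixed point gives convergence. The energy bound starts at index 1, since the initial values need
  have no gradient.\<close>

lemma generated_sequence_contraction:
  assumes y: "y \<in> L2 \<Omega>" "generated_sequence \<Omega> f W dt y u"
    and z: "z \<in> L2 \<Omega>" "generated_sequence \<Omega> f W dt z v"
  shows "L2_norm \<Omega> (\<lambda>x. u n x - v n x) \<le> q ^ n * L2_norm \<Omega> (\<lambda>x. y x - z x)"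
    and "energy_norm \<Omega> dt (\<lambda>x. u (Suc n) x - v (Suc n) x) \<le> K * (q ^ n * L2_norm \<Omega> (\<lambda>x. y x - z x))"
proof -
  have c: "energy_norm \<Omega> dt (\<lambda>x. u (Suc n) x - v (Suc n) x) \<le> K * L2_norm \<Omega> (\<lambda>x. u n x - v n x)"
    "L2_norm \<Omega> (\<lambda>x. u (Suc n) x - v (Suc n) x) \<le> q * L2_norm \<Omega> (\<lambda>x. u n x - v n x)" for n
    using y z step_contraction[OF generated_sequence_L2[OF y] generated_sequence_L2[OF z]]
    by (simp_all add: generated_sequence_iff)
  show *: "L2_norm \<Omega> (\<lambda>x. u n x - v n x) \<le> q ^ n * L2_norm \<Omega> (\<lambda>x. y x - z x)" for n
  proof (induction n)
    case 0
    then show ?case using y z by (simp add: generated_sequence_iff)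
  next
    case (Suc n)
    from c(2)[of n] mult_left_mono[OF Suc q_bounds(1)] show ?case by (simp add: mult.assoc)
  qed
  show "energy_norm \<Omega> dt (\<lambda>x. u (Suc n) x - v (Suc n) x) \<le> K * (q ^ n * L2_norm \<Omega> (\<lambda>x. y x - z x))"
    using c(1)[of n] mult_left_mono[OF *[of n] K_nonneg] by simp
qed

lemma generated_sequence_unique:
  assumes "y \<in> L2 \<Omega>" "generated_sequence \<Omega> f W dt y u" "generated_sequence \<Omega> f W dt y v"
  shows "eq_AE \<Omega> (u n) (v n)"
proof -
  have "L2_norm \<Omega> (\<lambda>x. u n x - v n x) \<le> 0"
    using generated_sequence_contraction(1)[OF assms(1,2,1,3), of n] by (simp add: L2_norm_def)
  then have "L2_norm \<Omega> (\<lambda>x. u n x - v n x) = 0" using L2_norm_nonneg by (rule antisym)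
  then have "AE x in lebesgue_on \<Omega>. u n x - v n x = 0"
    using L2_norm_eq_0_iff[OF L2_diff] generated_sequence_L2 assms by blast
  then show ?thesis unfolding eq_AE_def by eventually_elim simp
qed

lemma geometric_tendsto_0: "(\<lambda>n. c * (q ^ n * d)) \<longlonglongrightarrow> 0"
proof -
  have "(\<lambda>n. q ^ n) \<longlonglongrightarrow> 0" using q_bounds by (simp add: LIMSEQ_realpow_zero)
  then have "(\<lambda>n. c * (q ^ n * d)) \<longlonglongrightarrow> c * (0 * d)" by (intro tendsto_mult tendsto_const)
  then show ?thesis by simp
qed

lemma energy_norm_minus_commute:
  assumes "u \<in> W" "v \<in> W"
  shows "energy_norm \<Omega> dt (\<lambda>x. u x - v x) = energy_norm \<Omega> dt (\<lambda>x. v x - u x)"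
  using assms dt_pos W_H1 by (simp add: energy_norm_diff L2_norm_minus_commute[of _ "jet \<Omega> dt u"])

text \<open>The Banach iteration from 0, with increments estimated in the energy norm so that the
  limit stays in W and the equation passes to the limit.\<close>

lemma fixed_point_exists: "\<exists>ustar. step ustar ustar"
proof -
  obtain u where u: "generated_sequence \<Omega> f W dt (\<lambda>x. 0) u"
    using generated_sequence_exists[OF L2_zero] by blast
  define w where "w n = u (Suc n)" for n
  have wW: "w n \<in> W" for n using u by (simp add: w_def generated_sequence_def)
  note wL = W_L2[OF wW] and wH = W_H1[OF wW]
  have w_step: "step (w n) (w (Suc n))" for n using u by (simp add: w_def generated_sequence_iff)
  have shift: "generated_sequence \<Omega> f W dt (u 1) (\<lambda>n. u (Suc n))"
    using u by (simp add: generated_sequence_iff)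
  \<comment> \<open>The subtracted 0 is the initial value of the unshifted sequence.\<close>
  define C where "C = K * L2_norm \<Omega> (\<lambda>x. u 1 x - 0)"
  have C: "0 \<le> C" unfolding C_def by (intro mult_nonneg_nonneg K_nonneg L2_norm_nonneg)
  have inc: "energy_norm \<Omega> dt (\<lambda>x. w (Suc n) x - w n x) \<le> C * q ^ n" for n
    using generated_sequence_contraction(2)[OF generated_sequence_L2[OF L2_zero u] shift L2_zero u, of n]
    by (simp add: w_def C_def mult_ac)
  \<comment> \<open>The geometric tail bound reproduces itself when the increment from n to n + 1 is
    split off, so the induction on k must keep n arbitrary.\<close>
  have tail: "energy_norm \<Omega> dt (\<lambda>x. w (n + k) x - w n x) \<le> C * q ^ n / (1 - q)" for n k
  proof (induction k arbitrary: n)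
    case 0
    have "energy_norm \<Omega> dt (\<lambda>x. w n x - w n x) = 0"
      using dt_pos by (subst energy_norm_diff[OF wH wH]) (simp_all add: L2_norm_def)
    then show ?case using C q_bounds by simp
  next
    case (Suc k)
    have "energy_norm \<Omega> dt (\<lambda>x. w (n + Suc k) x - w n x)
        \<le> energy_norm \<Omega> dt (\<lambda>x. w (n + Suc k) x - w (Suc n) x) + energy_norm \<Omega> dt (\<lambda>x. w (Suc n) x - w n x)"
      using dt_pos by (intro energy_norm_triangle wH) simp
    also have "\<dots> \<le> C * q ^ Suc n / (1 - q) + C * q ^ n"
      using Suc.IH[of "Suc n"] inc[of n] by simp
    also have "\<dots> = C * q ^ n / (1 - q)"
      using q_bounds by (simp add: field_simps)
    finally show ?case .
  qed
  have tail_lim: "(\<lambda>n. C * q ^ n / (1 - q)) \<longlonglongrightarrow> 0"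
    using geometric_tendsto_0[of C "1 / (1 - q)"] by (simp add: mult.assoc)
  obtain ustar where ustar: "ustar \<in> W" "energy_converges \<Omega> dt w ustar"
  proof (rule W_complete[OF wW dt_pos])
    fix e :: real assume "e > 0"
    then have "\<forall>\<^sub>F n in sequentially. C * q ^ n / (1 - q) < e / 2"
      using order_tendstoD(2)[OF tail_lim, of "e / 2"] by simp
    then obtain N where N: "C * q ^ N / (1 - q) < e / 2"
      by (auto simp: eventually_sequentially)
    have close: "energy_norm \<Omega> dt (\<lambda>x. w m x - w N x) < e / 2" if "m \<ge> N" for m
      using le_less_trans[OF tail[of N "m - N"] N] that by simp
    have "energy_norm \<Omega> dt (\<lambda>x. w m x - w n x) < e" if "m \<ge> N" "n \<ge> N" for m n
      using energy_norm_triangle[OF wH wH wH, of dt m n N] close[OF that(1)] close[OF that(2)]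
        energy_norm_minus_commute[OF wW wW, of n N] dt_pos by simp
    then show "\<exists>N. \<forall>m\<ge>N. \<forall>n\<ge>N. energy_norm \<Omega> dt (\<lambda>x. w m x - w n x) < e" by blast
  qed (rule that)
  note uL = W_L2[OF ustar(1)] and uH = W_H1[OF ustar(1)]
  have L2_lim: "(\<lambda>n. L2_norm \<Omega> (\<lambda>x. w n x - ustar x)) \<longlonglongrightarrow> 0"
    by (rule Lim_null_comparison[OF _ ustar(2)[unfolded energy_converges_def]])
       (use dt_pos in \<open>simp add: L2_norm_nonneg L2_le_energy_norm\<close>)
  have "B_form \<Omega> dt ustar v = l_form \<Omega> f dt ustar v" if v: "v \<in> W" for v
  proof -
    note jv = jet_L2[OF W_H1[OF v], of dt] and vL = W_L2[OF v]
    \<comment> \<open>The left side of the equation converges because energy convergence is L^2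
      convergence of the jets; the right side because the source is Lipschitz in L^2.\<close>
    have "(\<lambda>n. L2_inner \<Omega> (jet \<Omega> dt (w n)) (jet \<Omega> dt v)) \<longlonglongrightarrow> L2_inner \<Omega> (jet \<Omega> dt ustar) (jet \<Omega> dt v)"
      by (rule L2_inner_tendsto[OF jet_L2[OF wH] jet_L2[OF uH] jv])
         (use ustar(2) dt_pos in \<open>simp add: energy_converges_def energy_norm_diff[OF wH uH]\<close>)
    then have "(\<lambda>n. B_form \<Omega> dt (w n) v) \<longlonglongrightarrow> B_form \<Omega> dt ustar v"
      using dt_pos by (simp add: B_form_eq_inner_jet)
    then have "(\<lambda>n. B_form \<Omega> dt (w (Suc n)) v) \<longlonglongrightarrow> B_form \<Omega> dt ustar v"
      by (rule LIMSEQ_Suc)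
    moreover have "(\<lambda>n. L2_inner \<Omega> (\<lambda>x. w n x + dt * f x (w n x)) v)
        \<longlonglongrightarrow> L2_inner \<Omega> (\<lambda>x. ustar x + dt * f x (ustar x)) v"
    proof (rule L2_inner_tendsto[OF step_source_L2[OF wL] step_source_L2[OF uL] vL],
        rule Lim_null_comparison[OF _ tendsto_mult_right_zero[OF L2_lim, where c = K]])
      show "\<forall>\<^sub>F n in sequentially.
          norm (L2_norm \<Omega> (\<lambda>x. (w n x + dt * f x (w n x)) - (ustar x + dt * f x (ustar x))))
          \<le> K * L2_norm \<Omega> (\<lambda>x. w n x - ustar x)"
        using step_source_contraction[OF wL uL] by (simp add: L2_norm_nonneg)
    qed
    moreover have "B_form \<Omega> dt (w (Suc n)) v = L2_inner \<Omega> (\<lambda>x. w n x + dt * f x (w n x)) v" for n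
      using w_step[of n] v by (simp add: step_def l_form_def L2_inner_def)
    ultimately show ?thesis
      by (simp add: LIMSEQ_unique l_form_def L2_inner_def)
  qed
  then show ?thesis using ustar(1) by (auto simp: step_def)
qed

lemma generated_sequence_converges:
  assumes fp: "step ustar ustar" and y: "y \<in> L2 \<Omega>" "generated_sequence \<Omega> f W dt y u"
  shows "energy_converges \<Omega> dt (\<lambda>n. u (Suc n)) ustar"
proof -
  have "ustar \<in> L2 \<Omega>" using fp W_L2 by (auto simp: step_def)
  moreover have "generated_sequence \<Omega> f W dt ustar (\<lambda>n. ustar)"
    using fp by (simp add: generated_sequence_iff)
  ultimately have "energy_norm \<Omega> dt (\<lambda>x. u (Suc n) x - ustar x) \<le> K * (q ^ n * L2_norm \<Omega> (\<lambda>x. y x - ustar x))" for n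
    by (rule generated_sequence_contraction(2)[OF y])
  then show ?thesis
    unfolding energy_converges_def
    by (intro Lim_null_comparison[OF _ geometric_tendsto_0] always_eventually allI)
       (use dt_pos in \<open>simp add: energy_norm_def\<close>)
qed

text \<open>At a fixed point the term with the integral of u w occurs in both \<open>B_form\<close>
  and \<open>l_form\<close> and cancels, leaving \<open>dt\<close> times the derivative of the
  energy.\<close>

lemma fixed_point_critical:
  assumes fp: "step ustar ustar" and w: "w \<in> W"
  shows "energy_deriv \<Omega> f ustar w = 0"
proof -
  have uW: "ustar \<in> W" using fp by (simp add: step_def)
  note uL = W_L2[OF uW] and wL = W_L2[OF w]
  note i1 = L2_integrable_inner[OF H1_wgrad(1)[OF W_H1[OF uW]] H1_wgrad(1)[OF W_H1[OF w]]]
    and i2 = L2_integrable_inner[OF f_compose_L2[OF uL] wL]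
    and i3 = L2_integrable_inner[OF uL wL]
  have "dt * energy_deriv \<Omega> f ustar w = B_form \<Omega> dt ustar w - l_form \<Omega> f dt ustar w"
    using i1 i2 i3
    by (simp add: energy_deriv_def B_form_def l_form_def distrib_right mult.assoc right_diff_distrib)
  also have "\<dots> = 0" using fp w by (simp add: step_def)
  finally show ?thesis using dt_pos by simp
qed

lemma energy_limit_unique:
  assumes w: "\<And>n. w n \<in> H1 \<Omega>" and u: "u \<in> H1 \<Omega>" "energy_converges \<Omega> dt w u"
    and v: "v \<in> H1 \<Omega>" "energy_converges \<Omega> dt w v"
  shows "eq_AE \<Omega> u v"
proof -
  have "L2_norm \<Omega> (\<lambda>x. u x - v x) \<le> energy_norm \<Omega> dt (\<lambda>x. w n x - u x) + energy_norm \<Omega> dt (\<lambda>x. w n x - v x)" for n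
    using L2_dist_triangle[OF H1_L2[OF u(1)] H1_L2[OF w] H1_L2[OF v(1)], of n]
      L2_norm_minus_commute[of \<Omega> u "w n"] dt_pos
      L2_le_energy_norm[of dt \<Omega> "\<lambda>x. w n x - u x"] L2_le_energy_norm[of dt \<Omega> "\<lambda>x. w n x - v x"] by simp
  moreover have "(\<lambda>n. energy_norm \<Omega> dt (\<lambda>x. w n x - u x) + energy_norm \<Omega> dt (\<lambda>x. w n x - v x)) \<longlonglongrightarrow> 0"
    using tendsto_add[OF u(2)[unfolded energy_converges_def] v(2)[unfolded energy_converges_def]] by simp
  ultimately have "L2_norm \<Omega> (\<lambda>x. u x - v x) \<le> 0"
    by (intro LIMSEQ_le_const) auto
  then have "L2_norm \<Omega> (\<lambda>x. u x - v x) = 0" using L2_norm_nonneg by (rule antisym)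
  then have "AE x in lebesgue_on \<Omega>. u x - v x = 0"
    using L2_norm_eq_0_iff[OF L2_diff[OF H1_L2[OF u(1)] H1_L2[OF v(1)]]] by simp
  then show ?thesis unfolding eq_AE_def by eventually_elim simp
qed

end

theorem theorem3p3:
  fixes \<Omega> :: "'a::euclidean_space set"
    and f :: "'a \<Rightarrow> real \<Rightarrow> real"
    and W :: "('a \<Rightarrow> real) set"
    and C_P \<rho> dt :: real
    and u0 :: "'a \<Rightarrow> real"
  assumes dim: "DIM('a) \<in> {1, 2, 3}"
    and domain: "polytopal_domain \<Omega>"
    and poincare: "poincare_constant \<Omega> C_P"
    and f_measurable: "\<And>s. (\<lambda>x. f x s) \<in> borel_measurable (lebesgue_on \<Omega>)"
    and W: "closed_subspace_H10 \<Omega> W"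
    and A: "assumption_A \<Omega> f \<rho>"
    and rho: "0 < \<rho>" "\<rho> \<le> 1 / C_P"
    and dt: "dt \<in> Lambda_f \<Omega> f \<rho>"
    and u0: "u0 \<in> L2 \<Omega>"
  shows "(\<exists>u. generated_sequence \<Omega> f W dt u0 u) \<and>
    (\<forall>u v. generated_sequence \<Omega> f W dt u0 u \<and> generated_sequence \<Omega> f W dt u0 v
       \<longrightarrow> (\<forall>n. eq_AE \<Omega> (u n) (v n))) \<and>
    (\<exists>ustar\<in>W.
       (\<forall>u. generated_sequence \<Omega> f W dt u0 u \<longrightarrow> energy_converges \<Omega> dt (\<lambda>n. u (Suc n)) ustar) \<and>
       (\<forall>v0\<in>L2 \<Omega>. \<forall>v. \<forall>vstar\<in>H10 \<Omega>.
          generated_sequence \<Omega> f W dt v0 v \<and> energy_converges \<Omega> dt (\<lambda>n. v (Suc n)) vstar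
            \<longrightarrow> eq_AE \<Omega> vstar ustar) \<and>
       has_gateaux_derivative_H10 \<Omega> (energy \<Omega> f) ustar (energy_deriv \<Omega> f ustar) \<and>
       (\<forall>w\<in>W. energy_deriv \<Omega> f ustar w = 0))"
proof -
  have bounded_open: "open \<Omega>" "bounded \<Omega>" using domain by (auto simp: polytopal_domain_def)
  have dt_pos: "0 < dt" using dt by (simp add: Lambda_f_def)
  have f_diff: "\<And>x s. x \<in> \<Omega> \<Longrightarrow> f x differentiable (at s)" using A by (simp add: assumption_A_def)
  obtain K where K: "0 \<le> K" "K < 1 + dt * \<rho>"
    "AE x in lebesgue_on \<Omega>. \<forall>s t. \<bar>(s + dt * f x s) - (t + dt * f x t)\<bar> \<le> K * \<bar>s - t\<bar>"
    by (rule Lambda_f_contraction[OF dt rho(1) f_diff]) (assumption | rule that)+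
  have C_P: "0 < C_P" using poincare by (simp add: poincare_constant_def)
  have coercive: "\<rho> * (L2_norm \<Omega> v)\<^sup>2 \<le> (L2_norm \<Omega> (wgrad \<Omega> v))\<^sup>2" if "v \<in> W" for v
  proof -
    have "v \<in> H10 \<Omega>" using that W by (auto simp: closed_subspace_H10_def)
    then have "(L2_norm \<Omega> v)\<^sup>2 \<le> C_P * (L2_norm \<Omega> (wgrad \<Omega> v))\<^sup>2"
      using poincare by (simp add: poincare_constant_def)
    then have "1 / C_P * (L2_norm \<Omega> v)\<^sup>2 \<le> (L2_norm \<Omega> (wgrad \<Omega> v))\<^sup>2"
      using C_P by (simp add: pos_divide_le_eq mult.commute)
    then show ?thesis using mult_right_mono[OF rho(2), of "(L2_norm \<Omega> v)\<^sup>2"] by simp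
  qed
  interpret iteration_problem \<Omega> f dt K W \<rho>
  proof
    show "continuous_on UNIV (f x)" if "x \<in> \<Omega>" for x
      using f_diff[OF that] by (auto intro!: continuous_at_imp_continuous_on differentiable_imp_continuous_within)
    show "(\<lambda>x. f x 0) \<in> L2 \<Omega>" using A by (simp add: assumption_A_def)
  qed (fact bounded_open f_measurable dt_pos K W rho(1) coercive)+
  \<comment> \<open>The fixed point does not depend on \<open>u0\<close>, so one limit serves all
    initial guesses, as the clause over \<open>v0\<close> demands.\<close>
  obtain ustar where fp: "step ustar ustar" using fixed_point_exists by blast
  then have uW: "ustar \<in> W" by (simp add: step_def)
  show ?thesis
  proof (intro conjI bexI[OF _ uW] allI impI ballI)
    show "\<exists>u. generated_sequence \<Omega> f W dt u0 u" by (rule generated_sequence_exists[OF u0])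
    show "eq_AE \<Omega> (u n) (v n)"
      if "generated_sequence \<Omega> f W dt u0 u \<and> generated_sequence \<Omega> f W dt u0 v" for u v n
      using generated_sequence_unique[OF u0] that by blast
    show "energy_converges \<Omega> dt (\<lambda>n. u (Suc n)) ustar" if "generated_sequence \<Omega> f W dt u0 u" for u
      by (rule generated_sequence_converges[OF fp u0 that])
    show "eq_AE \<Omega> vstar ustar"
      if "v0 \<in> L2 \<Omega>" "vstar \<in> H10 \<Omega>"
        "generated_sequence \<Omega> f W dt v0 v \<and> energy_converges \<Omega> dt (\<lambda>n. v (Suc n)) vstar" for v0 v vstar
    proof (rule energy_limit_unique[OF _ H10_H1[OF that(2)] conjunct2[OF that(3)] W_H1[OF uW]])
      show "v (Suc n) \<in> H1 \<Omega>" for n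
        using that(3) W_H1 by (simp add: generated_sequence_def)
      show "energy_converges \<Omega> dt (\<lambda>n. v (Suc n)) ustar"
        using generated_sequence_converges[OF fp that(1)] that(3) by blast
    qed
    show "has_gateaux_derivative_H10 \<Omega> (energy \<Omega> f) ustar (energy_deriv \<Omega> f ustar)"
      by (rule energy_has_gateaux_derivative[OF W_H1[OF uW]])
    show "energy_deriv \<Omega> f ustar w = 0" if "w \<in> W" for w
      by (rule fixed_point_critical[OF fp that])
  qed
qed

end
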